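(* Let $m\geq 1$ and $n\geq 1$ be integers and let $R\cong S\times T$ with $S=\prod_{i=1}^{m}R_{i}$ and $T=\prod_{j=1}^{n}\mathbb{F}_{j}$, where for every $1\leq i\leq m$, $R_{i}$ is a local Artinian principal ideal ring that is not a field, and $\mathbb{F}_{j}$ is a field for every $1\leq j\leq n$. Then $$In(R)_{SR}=H+\underbrace{K_{2}+\cdots+K_{2}}_{n\ \text{times}},$$ where $H$ is a connected graph.
   Context: All rings are commutative with identity. The inclusion ideal graph $In(R)$ is the simple graph whose vertices are all non-trivial ideals of $R$ (ideals different from $0$ and $R$), two distinct vertices being adjacent if and only if one of them is properly contained in the other. A local Artinian principal ideal ring has only finitely many ideals, and they are totally ordered by inclusion. For a graph $G$ with distance $d$ and open neighborhoods $N(\cdot)$, two different vertices $u,v$ are mutually maximally distant if $d(v,w)\leq d(u,v)$ for every $w\in N(u)$ and $d(u,w)\leq d(u,v)$ for every $w\in N(v)$. The strong resolving graph $G_{SR}$ has as vertices those $u\in V(G)$ for which there is some $v\in V(G)$ such that $u,v$ are mutually maximally distant, and $u,v$ are adjacent in $G_{SR}$ if and only if they are mutually maximally distant in $G$. $K_2$ is the complete graph on two vertices, $+$ denotes disjoint union of graphs, and equality is up to isomorphism. The graph with no vertices is counted as connected. *)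

theory Defs
  imports
    "HOL-Algebra.Chinese_Remainder"
    "Graph_Theory.Graph_Theory"
begin

locale local_ring = cring +
  assumes unique_maximalideal: "\<exists>!M. maximalideal M R"

locale artinian_ring = cring +
  assumes descending_chain_condition:
    "\<lbrakk> \<And>k::nat. ideal (I k) R; \<And>k. I (Suc k) \<subseteq> I k \<rbrakk> \<Longrightarrow> \<exists>N. \<forall>k\<ge>N. I k = I N"

locale principal_ideal_ring = cring +
  assumes every_ideal_principal: "ideal I R \<Longrightarrow> principalideal I R"

locale local_artinian_pir = local_ring + artinian_ring + principal_ideal_ring


text \<open>
  A simple graph is a loop-free digraph whose arc set is a symmetric set of pairs
  (locale \<^locale>\<open>pair_bidirected_digraph\<close>); each edge is represented by its two arcs.
  The distance of two vertices is the least number of arcs of a walk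
  between them, and it is infinite if there is no such walk.
\<close>

definition graph_dist :: "'v pair_pre_digraph \<Rightarrow> 'v \<Rightarrow> 'v \<Rightarrow> ereal" where
  "graph_dist G u v = wf_digraph.\<mu> (with_proj G) (\<lambda>_. 1) u v"

definition open_nbhd :: "'v pair_pre_digraph \<Rightarrow> 'v \<Rightarrow> 'v set" where
  "open_nbhd G u = {w \<in> pverts G. (u, w) \<in> parcs G}"

definition mutually_maximally_distant :: "'v pair_pre_digraph \<Rightarrow> 'v \<Rightarrow> 'v \<Rightarrow> bool" where
  "mutually_maximally_distant G u v \<longleftrightarrow>
     u \<in> pverts G \<and> v \<in> pverts G \<and> u \<noteq> v \<and>
     (\<forall>w \<in> open_nbhd G u. graph_dist G v w \<le> graph_dist G u v) \<and>
     (\<forall>w \<in> open_nbhd G v. graph_dist G u w \<le> graph_dist G u v)"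

definition strong_resolving_graph :: "'v pair_pre_digraph \<Rightarrow> 'v pair_pre_digraph" where
  "strong_resolving_graph G =
     \<lparr> pverts = {u \<in> pverts G. \<exists>v \<in> pverts G. mutually_maximally_distant G u v},
       parcs = {(u, v). mutually_maximally_distant G u v} \<rparr>"

definition inclusion_ideal_graph :: "('a, 'm) ring_scheme \<Rightarrow> 'a set pair_pre_digraph" where
  "inclusion_ideal_graph R =
     (let V = {I. ideal I R \<and> I \<noteq> {\<zero>\<^bsub>R\<^esub>} \<and> I \<noteq> carrier R}
      in \<lparr> pverts = V, parcs = {(I, J). I \<in> V \<and> J \<in> V \<and> (I \<subset> J \<or> J \<subset> I)} \<rparr>)"

definition disjoint_graph_union ::
    "'v pair_pre_digraph \<Rightarrow> 'w pair_pre_digraph \<Rightarrow> ('v + 'w) pair_pre_digraph" where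
  "disjoint_graph_union G H =
     \<lparr> pverts = pverts G <+> pverts H,
       parcs = {(Inl u, Inl v) | u v. (u, v) \<in> parcs G} \<union>
               {(Inr u, Inr v) | u v. (u, v) \<in> parcs H} \<rparr>"

definition graph_copies :: "nat \<Rightarrow> 'v pair_pre_digraph \<Rightarrow> (nat \<times> 'v) pair_pre_digraph" where
  "graph_copies n G =
     \<lparr> pverts = {1..n} \<times> pverts G,
       parcs = {((i, u), (i, v)) | i u v. i \<in> {1..n} \<and> (u, v) \<in> parcs G} \<rparr>"

definition complete_graph :: "nat \<Rightarrow> nat pair_pre_digraph" where
  "complete_graph k =
     \<lparr> pverts = {..<k}, parcs = {(u, v). u < k \<and> v < k \<and> u \<noteq> v} \<rparr>"

text \<open>The library predicate \<^const>\<open>connected\<close> excludes the graph with no vertices.\<close>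

definition connected_or_null :: "'v pair_pre_digraph \<Rightarrow> bool" where
  "connected_or_null G \<longleftrightarrow> pverts G = {} \<or> connected (with_proj G)"

end

theory Submission
  imports Defs "HOL-Algebra.Ring_Divisibility"
begin

text \<open>
  By nilpotency of the maximal ideal the elements of a local Artinian principal ideal ring are
  totally ordered by divisibility, so the orthogonal idempotents of the decomposition identify the
  ideal lattice of \<open>R\<close> with a product of chains, where exactly the fields contribute two-element
  chains. In this lattice comparable elements are at distance 1, complements at distance 3, and all
  other pairs at distance 2. It follows that comparable elements are never mutually maximally
  distant, complements always are, and an incomparable non-complementary pair is exactly if neither
  of its elements has a complement, or if its meet and its join are both proper. Hence the atom
  belonging to a field is related only to its complement, and this gives the \<open>n\<close> copies
  of \<open>K\<^sub>2\<close>. All remaining vertices are connected through elements without complement.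
\<close>

section \<open>Distances and isomorphisms\<close>

text \<open>The criterion at distance 2 has a single source. Only complements reach distance 3, so
  an incomparable non-complementary pair \<open>u\<close>, \<open>v\<close> fails exactly if a
  neighbour of one is the complement of the other. An element without complement cannot cause this.
  A complement \<open>v'\<close> of \<open>v\<close> satisfies \<open>v' \<le> u\<close> iff
  \<open>u\<close> and \<open>v\<close> join to the top, and \<open>u \<le> v'\<close> iff they meet
  in the bottom; so \<open>v'\<close> is no neighbour of \<open>u\<close> iff join and meet are both
  proper.

  A non-field factor supplies an inner value of its chain. This value gives the path between
  complements and the hub in the connectivity proof, and the index itself keeps the copies of
  \<open>K_2\<close> apart.

  The obstacle is the connectivity of the rest. Among elements without complement the edges are the
  incomparable pairs, and with three or more factors two classes of such elements are comparable to
  the whole hub and must be reached through a neighbour. With one field and one non-field the hub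
  falls apart: the remaining graph is then bipartite, may be empty, and needs an argument of its
  own.\<close>

lemma graph_dist_le_walk:
  assumes "pair_wf_digraph G" "pre_digraph.awalk (with_proj G) u p v"
  shows "graph_dist G u v \<le> ereal (real (length p))"
proof -
  interpret pair_wf_digraph G by fact
  have "awalk_cost (\<lambda>_. 1) p = real (length p)"
    by (induction p) auto
  then show ?thesis
    using min_cost_le_walk_cost[of u p v "\<lambda>_. 1"] assms(2)
    by (simp add: graph_dist_def)
qed

text \<open>The distance is an infimum of walk costs. A strict bound yields a walk below it, so
  attainment of the infimum need not be discussed.\<close>

lemma graph_dist_less_walk:
  assumes "pair_wf_digraph G" "graph_dist G u v < ereal (real (Suc n))"
  obtains p where "pre_digraph.awalk (with_proj G) u p v" "length p \<le> n"
proof -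
  interpret pair_wf_digraph G by fact
  have cost: "awalk_cost (\<lambda>_. 1) p = real (length p)" for p
    by (induction p) auto
  obtain p where "awalk u p v" "ereal (awalk_cost (\<lambda>_. 1) p) < ereal (real (Suc n))"
    using assms(2) unfolding graph_dist_def \<mu>_def INF_less_iff by auto
  then show ?thesis
    using that cost by auto
qed

lemma graph_dist_self:
  assumes "pair_wf_digraph G" "u \<in> pverts G"
  shows "graph_dist G u u = 0"
proof -
  interpret pair_wf_digraph G by fact
  have "graph_dist G u u \<le> 0"
    using graph_dist_le_walk[OF assms(1), of u "[]" u] assms(2)
    by (simp add: awalk_Nil_iff zero_ereal_def)
  moreover have "graph_dist G u u \<ge> 0"
    unfolding graph_dist_def \<mu>_def
    by (intro INF_greatest) (auto intro!: pos_cost_pos_awalk_cost)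
  ultimately show ?thesis by simp
qed

lemma graph_dist_adjacent:
  assumes "pair_wf_digraph G" "(u, v) \<in> parcs G" "u \<noteq> v"
  shows "graph_dist G u v = 1"
proof -
  interpret pair_wf_digraph G by fact
  have "graph_dist G u v \<le> 1"
    using graph_dist_le_walk[OF assms(1), of u "[(u, v)]" v] assms(2)
    by (auto simp: awalk_simps one_ereal_def dest: in_arcsD1 in_arcsD2)
  moreover have "\<not> graph_dist G u v < 1"
  proof
    assume "graph_dist G u v < 1"
    then have "graph_dist G u v < ereal (real (Suc 0))" by (simp add: one_ereal_def)
    then obtain p where "awalk u p v" "length p \<le> 0"
      using graph_dist_less_walk[OF assms(1)] by blast
    then show False using assms(3) by (auto simp: awalk_simps)
  qed
  ultimately show ?thesis by simp
qed

lemma graph_dist_common_neighbour: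
  assumes "pair_wf_digraph G" "(u, w) \<in> parcs G" "(w, v) \<in> parcs G" "u \<noteq> v" "(u, v) \<notin> parcs G"
  shows "graph_dist G u v = 2"
proof -
  interpret pair_wf_digraph G by fact
  have "graph_dist G u v \<le> 2"
    using graph_dist_le_walk[OF assms(1), of u "[(u, w), (w, v)]" v] assms(2,3)
    by (auto simp: awalk_simps dest: in_arcsD1 in_arcsD2)
  moreover have "\<not> graph_dist G u v < 2"
  proof
    assume "graph_dist G u v < 2"
    then have "graph_dist G u v < ereal (real (Suc 1))" by simp
    then obtain p where p: "awalk u p v" "length p \<le> 1"
      using graph_dist_less_walk[OF assms(1)] by blast
    then show False using assms(4,5)
      by (cases p) (auto simp: awalk_simps)
  qed
  ultimately show ?thesis by simp
qed

lemma graph_dist_three: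
  assumes "pair_wf_digraph G" "(u, w) \<in> parcs G" "(w, w') \<in> parcs G" "(w', v) \<in> parcs G"
    and "u \<noteq> v" "(u, v) \<notin> parcs G" "\<And>x. \<not> ((u, x) \<in> parcs G \<and> (x, v) \<in> parcs G)"
  shows "graph_dist G u v = 3"
proof -
  interpret pair_wf_digraph G by fact
  have "graph_dist G u v \<le> 3"
    using graph_dist_le_walk[OF assms(1), of u "[(u, w), (w, w'), (w', v)]" v] assms(2,3,4)
    by (auto simp: awalk_simps dest: in_arcsD1 in_arcsD2)
  moreover have "\<not> graph_dist G u v < 3"
  proof
    assume "graph_dist G u v < 3"
    then have "graph_dist G u v < ereal (real (Suc 2))" by simp
    then obtain p where p: "awalk u p v" "length p \<le> 2"
      using graph_dist_less_walk[OF assms(1)] by blast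
    show False
    proof (cases p)
      case Nil
      then show ?thesis using p assms(5) by (auto simp: awalk_simps)
    next
      case (Cons e q)
      then show ?thesis using p assms(6,7)
        by (cases q) (auto simp: awalk_simps)
    qed
  qed
  ultimately show ?thesis by simp
qed

text \<open>Arcs are pairs of vertices, so the vertex map induces the arc map, and head and tail
  remain the two projections.\<close>

lemma digraph_isoI:
  assumes "pair_wf_digraph G" "inj_on f (pverts G)"
    and "pverts H = f ` pverts G" "parcs H = map_prod f f ` parcs G"
  shows "digraph_iso (with_proj G) (with_proj H)"
proof -
  interpret pair_wf_digraph G by fact
  let ?h = "\<lparr>iso_verts = f, iso_arcs = map_prod f f, iso_head = snd, iso_tail = fst\<rparr>"
  have "parcs G \<subseteq> pverts G \<times> pverts G"
    using in_arcsD1 in_arcsD2 by auto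
  then have "inj_on (map_prod f f) (parcs G)"
    using map_prod_inj_on[OF assms(2) assms(2)] inj_on_subset by blast
  then have "pre_digraph.digraph_isomorphism (with_proj G) ?h"
    using assms(2) wf_digraph_axioms
    by (auto simp: pre_digraph.digraph_isomorphism_def)
  moreover have "with_proj H = app_iso ?h (with_proj G)"
    using assms(3,4) by (auto simp: app_iso_def with_proj_def)
  ultimately show ?thesis
    unfolding digraph_iso_def by blast
qed

section \<open>The comparability graph of a product of chains\<close>

text \<open>
  \<open>L\<close> is a product of bounded chains indexed by \<open>K\<close>; the \<open>k\<close>-th chain is represented by the values
  of the projection \<open>c k\<close> on \<open>L\<close>. The indices in \<open>F\<close> are those of the two-element chains.
\<close>

locale chain_product =
  fixes L :: "'v::order set" and zero unit :: 'v and K F :: "'k set"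
    and c :: "'k \<Rightarrow> 'v \<Rightarrow> 'x::order"
  assumes zero_in [simp, intro]: "zero \<in> L" and unit_in [simp, intro]: "unit \<in> L"
    and zero_le: "u \<in> L \<Longrightarrow> zero \<le> u" and le_unit: "u \<in> L \<Longrightarrow> u \<le> unit"
    and le_iff: "\<lbrakk>u \<in> L; v \<in> L\<rbrakk> \<Longrightarrow> u \<le> v \<longleftrightarrow> (\<forall>k\<in>K. c k u \<le> c k v)"
    and c_total: "\<lbrakk>k \<in> K; u \<in> L; v \<in> L\<rbrakk> \<Longrightarrow> c k u \<le> c k v \<or> c k v \<le> c k u"
    and glue: "(\<And>k. k \<in> K \<Longrightarrow> f k \<in> L) \<Longrightarrow> \<exists>u\<in>L. \<forall>k\<in>K. c k u = c k (f k)"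
    and zero_neq_unit: "k \<in> K \<Longrightarrow> c k zero \<noteq> c k unit"
    and F_sub: "F \<subseteq> K"
    and F_bool: "\<lbrakk>k \<in> F; u \<in> L\<rbrakk> \<Longrightarrow> c k u = c k zero \<or> c k u = c k unit"
    and not_F: "k \<in> K - F \<Longrightarrow> \<exists>u\<in>L. c k u \<noteq> c k zero \<and> c k u \<noteq> c k unit"
    and F_nonempty: "F \<noteq> {}" and not_all_F: "K \<noteq> F"
begin

section \<open>Coordinates, bounds and complements\<close>

definition V :: "'v set" where "V = L - {zero, unit}"

definition G :: "'v pair_pre_digraph" where
  "G = \<lparr>pverts = V, parcs = {(u, v). u \<in> V \<and> v \<in> V \<and> (u < v \<or> v < u)}\<rparr>"

text \<open>Within \<open>V\<close> these are exactly the complemented elements, see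
  \<open>compl_boolean\<close> and \<open>compl_ex\<close>.\<close>

definition boolean :: "'v \<Rightarrow> bool" where
  "boolean u \<longleftrightarrow> (\<forall>k\<in>K. c k u = c k zero \<or> c k u = c k unit)"

definition compl :: "'v \<Rightarrow> 'v \<Rightarrow> bool" where
  "compl u v \<longleftrightarrow> (\<forall>k\<in>K. c k u = c k zero \<and> c k v = c k unit \<or> c k u = c k unit \<and> c k v = c k zero)"

definition incomp :: "'v \<Rightarrow> 'v \<Rightarrow> bool" where
  "incomp u v \<longleftrightarrow> \<not> u \<le> v \<and> \<not> v \<le> u"

text \<open>Coordinatewise, since the locale has no join operation: in a chain the join is the
  larger value, so the join of \<open>u\<close> and \<open>v\<close> misses \<open>unit\<close> iff
  at some index both values miss the top. Dually for \<open>meet_proper\<close>.\<close>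

definition join_proper :: "'v \<Rightarrow> 'v \<Rightarrow> bool" where
  "join_proper u v \<longleftrightarrow> (\<exists>k\<in>K. c k u \<noteq> c k unit \<and> c k v \<noteq> c k unit)"

definition meet_proper :: "'v \<Rightarrow> 'v \<Rightarrow> bool" where
  "meet_proper u v \<longleftrightarrow> (\<exists>k\<in>K. c k u \<noteq> c k zero \<and> c k v \<noteq> c k zero)"

text \<open>The chains have no carriers of their own. A coordinate is therefore prescribed by naming
  an element of \<open>L\<close> that has it, usually \<open>zero\<close>, \<open>unit\<close> or an
  element with an inner value.\<close>

lemma glueE:
  assumes "\<And>k. k \<in> K \<Longrightarrow> f k \<in> L"
  obtains u where "u \<in> L" "\<forall>k\<in>K. c k u = c k (f k)"
  using glue[of f] assms by blast

lemma V_L [simp]: "u \<in> V \<Longrightarrow> u \<in> L"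
  by (simp add: V_def)

lemma c_zero_le [simp]: "\<lbrakk>k \<in> K; u \<in> L\<rbrakk> \<Longrightarrow> c k zero \<le> c k u"
  using zero_le le_iff zero_in by blast

lemma c_le_unit [simp]: "\<lbrakk>k \<in> K; u \<in> L\<rbrakk> \<Longrightarrow> c k u \<le> c k unit"
  using le_unit le_iff unit_in by blast

lemma c_le_zero [simp]: "\<lbrakk>k \<in> K; u \<in> L\<rbrakk> \<Longrightarrow> c k u \<le> c k zero \<longleftrightarrow> c k u = c k zero"
  using c_zero_le[of k u] by (metis order_antisym order_refl)

lemma c_unit_le [simp]: "\<lbrakk>k \<in> K; u \<in> L\<rbrakk> \<Longrightarrow> c k unit \<le> c k u \<longleftrightarrow> c k u = c k unit"
  using c_le_unit[of k u] by (metis order_antisym order_refl)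

lemma c_not_le: "\<lbrakk>k \<in> K; u \<in> L; v \<in> L\<rbrakk> \<Longrightarrow> \<not> c k u \<le> c k v \<longleftrightarrow> c k v < c k u"
  using c_total by (meson leD less_le_not_le)

lemma eq_iff: "\<lbrakk>u \<in> L; v \<in> L\<rbrakk> \<Longrightarrow> u = v \<longleftrightarrow> (\<forall>k\<in>K. c k u = c k v)"
  using le_iff by (metis order_antisym order_refl)

lemma V_iff: "u \<in> V \<longleftrightarrow> u \<in> L \<and> (\<exists>k\<in>K. c k u \<noteq> c k zero) \<and> (\<exists>k\<in>K. c k u \<noteq> c k unit)"
  using eq_iff unfolding V_def by auto

lemma incomp_iff:
  "\<lbrakk>u \<in> L; v \<in> L\<rbrakk> \<Longrightarrow> incomp u v \<longleftrightarrow> (\<exists>k\<in>K. c k v < c k u) \<and> (\<exists>k\<in>K. c k u < c k v)"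
  unfolding incomp_def using le_iff c_not_le by blast

lemma incomp_sym: "incomp u v \<longleftrightarrow> incomp v u"
  unfolding incomp_def by auto

lemma compl_sym: "compl u v \<longleftrightarrow> compl v u"
  unfolding compl_def by auto

lemma compl_boolean: "compl u v \<Longrightarrow> boolean u"
  unfolding compl_def boolean_def by auto

lemma compl_V:
  assumes "u \<in> V" "v \<in> L" "compl u v"
  shows "v \<in> V"
proof -
  obtain k l where k: "k \<in> K" "c k u \<noteq> c k zero" and l: "l \<in> K" "c l u \<noteq> c l unit"
    using assms(1) V_iff by auto
  then have "c k v = c k zero" "c l v = c l unit"
    using assms(3) unfolding compl_def by blast+
  then show ?thesis
    using k l assms(2) zero_neq_unit unfolding V_iff by metis
qed

lemma compl_ex:
  assumes "u \<in> V" "boolean u"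
  obtains u' where "u' \<in> V" "compl u u'"
proof -
  obtain u' where u': "u' \<in> L" "\<forall>k\<in>K. c k u' = c k (if c k u = c k zero then unit else zero)"
    by (rule glueE[of "\<lambda>k. if c k u = c k zero then unit else zero"]) (use zero_in in auto)
  then have "compl u u'"
    using assms(2) zero_neq_unit unfolding compl_def boolean_def by auto
  then show thesis using that compl_V[OF assms(1) u'(1)] by blast
qed

lemma compl_unique:
  assumes "u \<in> L" "v \<in> L" "compl w u" "compl w v"
  shows "u = v"
  using assms zero_neq_unit unfolding eq_iff[OF assms(1,2)] compl_def by metis

section \<open>Distances in the comparability graph\<close>

lemma G_simps [simp]:
  "pverts G = V" "(u, v) \<in> parcs G \<longleftrightarrow> u \<in> V \<and> v \<in> V \<and> (u < v \<or> v < u)"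
  by (auto simp: G_def)

lemma pair_wf_G: "pair_wf_digraph G"
  by unfold_locales auto

lemma compl_incomp:
  assumes "u \<in> V" "v \<in> V" "compl u v"
  shows "incomp u v"
proof -
  obtain k l where "k \<in> K" "c k u \<noteq> c k zero" "l \<in> K" "c l u \<noteq> c l unit"
    using assms(1) V_iff by auto
  then show ?thesis
    using assms(3) incomp_iff[of u v] assms(1,2) zero_neq_unit
    unfolding compl_def by (metis V_L c_le_unit order_less_le unit_in zero_in)
qed

text \<open>The path is \<open>u < a > b < v\<close>: \<open>a\<close> raises coordinate
  \<open>i\<close> of \<open>u\<close> from bottom to the inner value \<open>g\<close>,
  \<open>b\<close> keeps this coordinate alone, and \<open>v\<close> has the top there. A path of
  length 2 would need a common lower or upper bound in \<open>V\<close>, but complements meet in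
  \<open>zero\<close> and join to \<open>unit\<close>. Both directions are stated because
  \<open>dist_compl\<close> may have to swap \<open>u\<close> and \<open>v\<close> before symmetry
  of the distance is known.\<close>

lemma dist_compl_aux:
  assumes u: "u \<in> V" and v: "v \<in> V" and cp: "compl u v"
    and i: "i \<in> K - F" "c i u = c i zero"
  shows "graph_dist G u v = 3 \<and> graph_dist G v u = 3"
proof -
  obtain g where g: "g \<in> L" "c i g \<noteq> c i zero" "c i g \<noteq> c i unit"
    using not_F i(1) by blast
  have iK: "i \<in> K" using i by blast
  have vi: "c i v = c i unit"
    using cp i zero_neq_unit unfolding compl_def by auto
  obtain a where a: "a \<in> L" "\<forall>k\<in>K. c k a = c k (if k = i then g else u)"
    by (rule glueE[of "\<lambda>k. if k = i then g else u"]) (use g u in auto)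
  obtain b where b: "b \<in> L" "\<forall>k\<in>K. c k b = c k (if k = i then g else zero)"
    by (rule glueE[of "\<lambda>k. if k = i then g else zero"]) (use g in auto)
  obtain k where k: "k \<in> K" "c k u \<noteq> c k zero"
    using u V_iff by auto
  have ki: "k \<noteq> i" using k i by auto
  have aV: "a \<in> V" and bV: "b \<in> V"
    unfolding V_iff using a b iK g by auto
  have "u \<le> a" "u \<noteq> a"
    using a u i iK g by (auto simp: le_iff)
  then have ua: "u < a" by simp
  have "b \<le> a" using a b u i iK g by (auto simp: le_iff)
  moreover have "b \<noteq> a" using a b k ki by force
  ultimately have ba: "b < a" by simp
  have "b \<le> v" using b v vi iK g by (auto simp: le_iff)
  moreover have "b \<noteq> v" using b vi iK g by auto
  ultimately have bv: "b < v" by simp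
  have inc: "incomp u v" using compl_incomp[OF u v cp] .
  have nox: "\<not> ((u, x) \<in> parcs G \<and> (x, v) \<in> parcs G)" for x
  proof
    assume "(u, x) \<in> parcs G \<and> (x, v) \<in> parcs G"
    then have x: "x \<in> V" "u < x \<or> x < u" "x < v \<or> v < x" by auto
    then consider "x \<le> u" "x \<le> v" | "u \<le> x" "v \<le> x" | "u \<le> v" | "v \<le> u"
      by (meson less_imp_le order_trans)
    then show False
    proof cases
      case 1
      then have "\<forall>k\<in>K. c k x = c k zero"
        using cp u v x unfolding compl_def by (metis V_L c_le_zero le_iff)
      then show False using x V_iff by blast
    next
      case 2
      then have "\<forall>k\<in>K. c k x = c k unit"
        using cp u v x unfolding compl_def by (metis V_L c_unit_le le_iff)
      then show False using x V_iff by blast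
    qed (use inc in \<open>auto simp: incomp_def\<close>)
  qed
  have "graph_dist G u v = 3"
    using ua ba bv inc nox u v aV bV
    by (intro graph_dist_three[OF pair_wf_G, of u a b v]) (auto simp: incomp_def)
  moreover have "graph_dist G v u = 3"
    using ua ba bv inc nox u v aV bV
    by (intro graph_dist_three[OF pair_wf_G, of v b a u]) (auto simp: incomp_def)
  ultimately show ?thesis by blast
qed

lemma dist_compl:
  assumes "u \<in> V" "v \<in> V" "compl u v"
  shows "graph_dist G u v = 3"
proof -
  obtain i where i: "i \<in> K - F" using not_all_F F_sub by blast
  then have "c i u = c i zero \<or> c i v = c i zero"
    using assms(3) unfolding compl_def by blast
  then show ?thesis
    using dist_compl_aux i assms compl_sym by blast
qed

lemma dist_comparable:
  assumes "u \<in> V" "v \<in> V" "u \<noteq> v" "\<not> incomp u v"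
  shows "graph_dist G u v = 1"
  using assms by (intro graph_dist_adjacent pair_wf_G) (auto simp: incomp_def)

text \<open>One index \<open>k\<close> where complementarity fails gives a common neighbour. If both
  values at \<open>k\<close> are nonzero, the smaller one with \<open>zero\<close> elsewhere lies
  below both elements; otherwise both values miss the top, and the larger one with
  \<open>unit\<close> elsewhere lies above both.\<close>

lemma dist_incomp:
  assumes u: "u \<in> V" and v: "v \<in> V" and inc: "incomp u v" and nc: "\<not> compl u v"
  shows "graph_dist G u v = 2"
proof -
  obtain k where k: "k \<in> K"
    "c k u \<noteq> c k zero \<and> c k v \<noteq> c k zero \<or> c k u \<noteq> c k unit \<and> c k v \<noteq> c k unit"
    using nc unfolding compl_def using zero_neq_unit by metis
  obtain w where w: "w \<in> V" "w < u \<and> w < v \<or> u < w \<and> v < w"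
  proof (cases "c k u \<noteq> c k zero \<and> c k v \<noteq> c k zero")
    case True
    define m where "m = (if c k u \<le> c k v then u else v)"
    have m: "m \<in> L" "c k m \<le> c k u" "c k m \<le> c k v" "c k m \<noteq> c k zero"
      using True u v k c_total[of k u v] by (auto simp: m_def)
    obtain w where w: "w \<in> L" "\<forall>l\<in>K. c l w = c l (if l = k then m else zero)"
      by (rule glueE[of "\<lambda>l. if l = k then m else zero"]) (use m in auto)
    have "w \<le> u" "w \<le> v"
      using w u v m by (auto simp: le_iff)
    then have "w < u \<and> w < v"
      using inc unfolding incomp_def by auto
    moreover have "w \<in> V"
      using w k m calculation u by (auto simp: V_def dest: le_unit)
    ultimately show ?thesis using that by blast
  next
    case False
    define m where "m = (if c k u \<le> c k v then v else u)"
    have m: "m \<in> L" "c k u \<le> c k m" "c k v \<le> c k m" "c k m \<noteq> c k unit"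
      using False u v k c_total[of k u v] by (auto simp: m_def)
    obtain w where w: "w \<in> L" "\<forall>l\<in>K. c l w = c l (if l = k then m else unit)"
      by (rule glueE[of "\<lambda>l. if l = k then m else unit"]) (use m in auto)
    have "u \<le> w" "v \<le> w"
      using w u v m by (auto simp: le_iff)
    then have "u < w \<and> v < w"
      using inc unfolding incomp_def by auto
    moreover have "w \<in> V"
      using w k m calculation u by (auto simp: V_def dest: zero_le)
    ultimately show ?thesis using that by blast
  qed
  then show ?thesis
    using u v inc
    by (intro graph_dist_common_neighbour[OF pair_wf_G, of u w v]) (auto simp: incomp_def)
qed

lemma dist_le_3:
  assumes "u \<in> V" "v \<in> V"
  shows "graph_dist G u v \<le> 3"
  using dist_compl[OF assms] dist_comparable[OF assms] dist_incomp[OF assms]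
    graph_dist_self[OF pair_wf_G, of u] assms
  by (cases "u = v"; cases "incomp u v"; cases "compl u v") auto

text \<open>The element \<open>w\<close> is a neighbour of one endpoint at distance at least 2 from
  the other, which defeats a pair at distance 1. If \<open>u < v\<close> is strict at
  \<open>k\<close>, then keeping \<open>u\<close> at \<open>k\<close> and taking the top elsewhere
  works unless \<open>v\<close> is already top off \<open>k\<close>; the dual choice works unless
  \<open>u\<close> is bottom off \<open>k\<close>.\<close>

lemma escape_comparable:
  assumes u: "u \<in> V" and v: "v \<in> V" and uv: "u < v"
  shows "\<exists>w\<in>V. u < w \<and> incomp w v \<or> w < v \<and> incomp w u"
proof -
  have le: "c k u \<le> c k v" if "k \<in> K" for k
    using uv u v that le_iff[of u v] by auto
  obtain k where k: "k \<in> K" "c k u < c k v"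
    using uv u v le le_iff[of v u] by (metis V_L c_not_le leD)
  have up: ?thesis if "k \<in> K" "j \<in> K" "j \<noteq> k" "c k u < c k v" "c j v \<noteq> c j unit" for k j
  proof -
    obtain w where w: "w \<in> L" "\<forall>l\<in>K. c l w = c l (if l = k then u else unit)"
      by (rule glueE[of "\<lambda>l. if l = k then u else unit"]) (use u in auto)
    have "u \<le> w" using w u by (auto simp: le_iff)
    moreover have inc: "incomp w v"
      unfolding incomp_def using w u v that by (auto simp: le_iff)
    ultimately have "u < w" using uv unfolding incomp_def by auto
    moreover have "w \<in> V"
      using w u v inc \<open>u < w\<close> by (auto simp: V_def incomp_def dest: zero_le le_unit)
    ultimately show ?thesis using inc by blast
  qed
  have down: ?thesis if "k \<in> K" "j \<in> K" "j \<noteq> k" "c k u < c k v" "c j u \<noteq> c j zero" for k j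
  proof -
    obtain w where w: "w \<in> L" "\<forall>l\<in>K. c l w = c l (if l = k then v else zero)"
      by (rule glueE[of "\<lambda>l. if l = k then v else zero"]) (use v in auto)
    have "w \<le> v" using w v by (auto simp: le_iff)
    moreover have inc: "incomp w u"
      unfolding incomp_def using w u v that by (auto simp: le_iff)
    ultimately have "w < v" using uv unfolding incomp_def by auto
    moreover have "w \<in> V"
      using w u v inc \<open>w < v\<close> by (auto simp: V_def incomp_def dest: zero_le le_unit)
    ultimately show ?thesis using inc by blast
  qed
  obtain i where i: "i \<in> K - F" using not_all_F F_sub by blast
  then obtain j where j: "j \<in> K" "j \<noteq> k"
    using F_nonempty F_sub by (cases "k = i") auto
  show ?thesis
  proof (rule ccontr)
    assume no: "\<not> ?thesis"
    then have kj: "c l v = c l unit \<and> c l u = c l zero" if "l \<in> K" "l \<noteq> k" for l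
      using up[of k l] down[of k l] k that by blast
    \<comment> \<open>Off \<open>k\<close> the pair now consists of bottom and top, so it is strict
      at \<open>j\<close> as well. Applying \<open>up\<close> with \<open>j\<close> and
      \<open>k\<close> exchanged makes \<open>v\<close> top at \<open>k\<close> too, hence
      everywhere.\<close>
    then have "c j u < c j v"
      using j by (simp add: order_less_le zero_neq_unit)
    then have "c k v = c k unit"
      using up[of j k] no k j by blast
    with kj have "\<forall>l\<in>K. c l v = c l unit" by blast
    then show False using v V_iff by blast
  qed
qed

section \<open>Mutual maximal distance in terms of the order\<close>

definition related :: "'v \<Rightarrow> 'v \<Rightarrow> bool" where
  "related u v \<longleftrightarrow> u \<in> V \<and> v \<in> V \<and> (compl u v \<or> incomp u v \<and>
     (\<not> boolean u \<and> \<not> boolean v \<or> join_proper u v \<and> meet_proper u v))"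

lemma related_sym: "related u v \<Longrightarrow> related v u"
  unfolding related_def join_proper_def meet_proper_def using compl_sym incomp_sym by blast

text \<open>The complement \<open>v'\<close> has distance 3 from \<open>v\<close>, too far for a
  neighbour of \<open>u\<close>, so \<open>u\<close> and \<open>v'\<close> are incomparable. Where
  \<open>u\<close> is strictly below \<open>v'\<close>, the value of \<open>v'\<close> is top and
  that of \<open>v\<close> bottom, which witnesses a proper join; the opposite strict index
  witnesses a proper meet.\<close>

lemma proper_of_dist:
  assumes u: "u \<in> V" and v: "v \<in> V" and inc: "incomp u v" and nc: "\<not> compl u v"
    and b: "boolean v" and max: "\<forall>w\<in>open_nbhd G u. graph_dist G v w \<le> graph_dist G u v"
  shows "join_proper u v \<and> meet_proper u v"
proof -
  obtain v' where v': "v' \<in> V" "compl v v'" using compl_ex[OF v b] .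
  have "v' \<notin> open_nbhd G u"
    using max dist_compl[OF v v'] dist_incomp[OF u v inc nc] by fastforce
  moreover have "v' \<noteq> u" using v' nc compl_sym by blast
  ultimately have inc': "\<not> v' \<le> u" "\<not> u \<le> v'"
    using u v' unfolding open_nbhd_def by auto
  obtain k where k: "k \<in> K" "c k u < c k v'"
    using inc'(1) u v' by (auto simp: le_iff c_not_le)
  then have "c k v' \<noteq> c k zero" using u c_zero_le[of k u] by (auto simp: less_le_not_le)
  then have "c k v' = c k unit" "c k v = c k zero"
    using v' k unfolding compl_def by blast+
  then have 1: "join_proper u v"
    unfolding join_proper_def using k zero_neq_unit by (metis order_less_irrefl)
  obtain l where l: "l \<in> K" "c l v' < c l u"
    using inc'(2) u v' by (auto simp: le_iff c_not_le)
  then have "c l v' \<noteq> c l unit" using u c_le_unit[of l u] by (auto simp: less_le_not_le)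
  then have "c l v' = c l zero" "c l v = c l unit"
    using v' l unfolding compl_def by blast+
  then have 2: "meet_proper u v"
    unfolding meet_proper_def using l zero_neq_unit by (metis order_less_irrefl)
  show ?thesis using 1 2 by blast
qed

text \<open>Only the complement of \<open>v\<close> is farther than 2 from \<open>v\<close>. If it
  exists, the index of the proper join prevents it from lying below \<open>u\<close> and the index
  of the proper meet from lying above \<open>u\<close>.\<close>

lemma dist_of_proper:
  assumes u: "u \<in> V" and v: "v \<in> V" and inc: "incomp u v" and nc: "\<not> compl u v"
    and r: "\<not> boolean v \<or> join_proper u v \<and> meet_proper u v"
    and w: "w \<in> open_nbhd G u"
  shows "graph_dist G v w \<le> graph_dist G u v"
proof -
  have wV: "w \<in> V" and adj: "u < w \<or> w < u" using w unfolding open_nbhd_def by auto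
  have "\<not> compl v w"
  proof
    assume cp: "compl v w"
    then have "join_proper u v" "meet_proper u v" using r compl_boolean by blast+
    then obtain k l where kl: "k \<in> K" "c k u \<noteq> c k unit" "c k v \<noteq> c k unit"
        "l \<in> K" "c l u \<noteq> c l zero" "c l v \<noteq> c l zero"
      unfolding join_proper_def meet_proper_def by blast
    then have "c k w = c k unit" "c l w = c l zero"
      using cp unfolding compl_def by blast+
    then have "\<not> c k w \<le> c k u" "\<not> c l u \<le> c l w"
      using kl u by simp_all
    then have "\<not> w \<le> u" "\<not> u \<le> w"
      using kl u wV le_iff by (blast dest: V_L)+
    then show False using adj by auto
  qed
  then have "graph_dist G v w \<le> 2"
    using dist_comparable[OF v wV] dist_incomp[OF v wV]
      graph_dist_self[OF pair_wf_G, of v] v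
    by (cases "v = w"; cases "incomp v w") auto
  then show ?thesis using dist_incomp[OF u v inc nc] by simp
qed

text \<open>Read off the classification of distances, without reversing walks.\<close>

lemma graph_dist_sym:
  assumes "u \<in> V" "v \<in> V"
  shows "graph_dist G u v = graph_dist G v u"
proof -
  consider "u = v" | "u \<noteq> v" "\<not> incomp u v" | "compl u v" | "incomp u v" "\<not> compl u v" by blast
  then show ?thesis
  proof cases
    case 2
    then show ?thesis using assms dist_comparable incomp_sym by metis
  next
    case 3
    then show ?thesis using assms dist_compl compl_sym by metis
  next
    case 4
    then show ?thesis using assms dist_incomp compl_sym incomp_sym by metis
  qed simp
qed

text \<open>One reason for each distance: 3 is the maximum, so complements qualify; at distance 1
  there is an escaping neighbour; at distance 2 only a complement can be farther away.\<close>

lemma mmd_iff: "mutually_maximally_distant G u v \<longleftrightarrow> related u v"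
proof (cases "u \<in> V \<and> v \<in> V")
  case False
  then show ?thesis unfolding mutually_maximally_distant_def related_def by auto
next
  case True
  then have u: "u \<in> V" and v: "v \<in> V" by auto
  have nb: "w \<in> V" if "w \<in> open_nbhd G x" for w x
    using that unfolding open_nbhd_def by auto
  consider (compl) "compl u v" | (comparable) "\<not> compl u v" "\<not> incomp u v"
    | (incomp) "\<not> compl u v" "incomp u v" by blast
  then show ?thesis
  proof cases
    case compl
    moreover have "u \<noteq> v" using compl_incomp[OF u v compl] unfolding incomp_def by auto
    ultimately show ?thesis
      using u v dist_compl[OF u v] dist_le_3 nb
      unfolding mutually_maximally_distant_def related_def by auto
  next
    case comparable
    have "\<not> mutually_maximally_distant G u v"
    proof
      assume m: "mutually_maximally_distant G u v"
      have gt: "\<not> graph_dist G x y \<le> 1" if "x \<in> V" "y \<in> V" "incomp x y" for x y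
        using that dist_compl[of x y] dist_incomp[of x y] by (cases "compl x y") auto
      have d: "graph_dist G u v = 1" and ne: "u \<noteq> v"
        using m dist_comparable[OF u v _ comparable(2)]
        unfolding mutually_maximally_distant_def by auto
      \<comment> \<open>It is not known which endpoint owns the escaping neighbour, so the pair is
        renamed \<open>x\<close>, \<open>y\<close> with \<open>w\<close> adjacent to
        \<open>x\<close>.\<close>
      obtain x y w where "w \<in> V" "x = u \<and> y = v \<or> x = v \<and> y = u" "x < w \<or> w < x" "incomp w y"
        using comparable(2) ne escape_comparable[OF u v] escape_comparable[OF v u]
        unfolding incomp_def by (metis order_less_le)
      then show False
        using m gt[of y w] d u v incomp_sym unfolding mutually_maximally_distant_def open_nbhd_def
        by auto
    qed
    then show ?thesis using comparable unfolding related_def by blast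
  next
    case incomp
    note nc = incomp(1) and inc = incomp(2)
    have nc': "\<not> compl v u" and inc': "incomp v u" using nc inc compl_sym incomp_sym by blast+
    have sym: "join_proper v u = join_proper u v" "meet_proper v u = meet_proper u v"
      unfolding join_proper_def meet_proper_def by blast+
    have ne: "u \<noteq> v" using inc unfolding incomp_def by auto
    show ?thesis
    proof
      assume "mutually_maximally_distant G u v"
      then show "related u v"
        using proper_of_dist[OF u v inc nc] proper_of_dist[OF v u inc' nc'] sym inc u v
          graph_dist_sym[OF u v]
        unfolding mutually_maximally_distant_def related_def by auto
    next
      assume "related u v"
      then show "mutually_maximally_distant G u v"
        using dist_of_proper[OF u v inc nc] dist_of_proper[OF v u inc' nc'] sym u v ne nc
          graph_dist_sym[OF u v]
        unfolding mutually_maximally_distant_def related_def by auto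
    qed
  qed
qed

lemma related_nonboolean:
  "\<lbrakk>u \<in> V; v \<in> V; \<not> boolean u; \<not> boolean v\<rbrakk> \<Longrightarrow> related u v \<longleftrightarrow> incomp u v"
  unfolding related_def using compl_boolean by blast

section \<open>Reachability, atoms and coatoms\<close>

abbreviation reach :: "'v \<Rightarrow> 'v \<Rightarrow> bool" where
  "reach \<equiv> related\<^sup>*\<^sup>*"

lemma reach_sym: "reach u v \<Longrightarrow> reach v u"
proof (induction rule: rtranclp_induct)
  case (step y z)
  then show ?case
    using related_sym converse_rtranclp_into_rtranclp by metis
qed simp

lemma reach_two_steps: "related u v \<Longrightarrow> related v w \<Longrightarrow> reach u w"
  by (meson r_into_rtranclp rtranclp.rtrancl_into_rtrancl)

lemma not_boolean_V:
  assumes "u \<in> L" "\<not> boolean u"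
  shows "u \<in> V"
  using assms unfolding V_iff boolean_def by blast

lemma c_less_unit:
  "\<lbrakk>k \<in> K; u \<in> L; c k u \<noteq> c k unit\<rbrakk> \<Longrightarrow> c k u < c k unit"
  by (simp add: order_less_le)

lemma c_zero_less:
  "\<lbrakk>k \<in> K; u \<in> L; c k u \<noteq> c k zero\<rbrakk> \<Longrightarrow> c k zero < c k u"
  using c_zero_le[of k u] by (simp add: order_less_le)

text \<open>For \<open>l \<in> F\<close> these two elements form one of the copies of \<open>K\<^sub>2\<close>.\<close>

definition atom :: "'k \<Rightarrow> 'v \<Rightarrow> bool" where
  "atom l u \<longleftrightarrow> u \<in> L \<and> (\<forall>k\<in>K. c k u = c k (if k = l then unit else zero))"

definition coatom :: "'k \<Rightarrow> 'v \<Rightarrow> bool" where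
  "coatom l u \<longleftrightarrow> u \<in> L \<and> (\<forall>k\<in>K. c k u = c k (if k = l then zero else unit))"

lemma K_other:
  assumes "l \<in> K" obtains k where "k \<in> K" "k \<noteq> l"
  using assms not_all_F F_nonempty F_sub by blast

lemma atom_V:
  assumes "l \<in> K" "atom l u" shows "u \<in> V"
proof -
  obtain k where "k \<in> K" "k \<noteq> l" using K_other[OF assms(1)] .
  then have "c k u = c k zero" "c l u = c l unit"
    using assms unfolding atom_def by auto
  then show ?thesis
    using assms \<open>k \<in> K\<close> zero_neq_unit unfolding V_iff atom_def by metis
qed

lemma atom_ex: assumes "l \<in> K" obtains u where "atom l u"
  by (rule glueE[of "\<lambda>k. if k = l then unit else zero"]) (use that in \<open>auto simp: atom_def\<close>)

lemma coatom_ex: assumes "l \<in> K" obtains u where "coatom l u"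
  by (rule glueE[of "\<lambda>k. if k = l then zero else unit"]) (use that in \<open>auto simp: coatom_def\<close>)

lemma atom_compl_coatom: "\<lbrakk>atom l u; coatom l v\<rbrakk> \<Longrightarrow> compl u v"
  unfolding atom_def coatom_def compl_def by auto

lemma coatom_V:
  assumes "l \<in> K" "coatom l u" shows "u \<in> V"
proof -
  obtain v where "atom l v" using atom_ex[OF assms(1)] .
  then show ?thesis
    using compl_V atom_V assms atom_compl_coatom coatom_def by blast
qed

text \<open>An atom is nonzero at \<open>l\<close> only, so an element with proper meet is nonzero
  there too. The chain of a field has two values, so that element is top at \<open>l\<close> and
  lies above the atom. Incomparability is thus impossible, and only the unique complement
  remains.\<close>

lemma related_atom:
  assumes l: "l \<in> F" and a: "atom l u" and r: "related u v"
  shows "coatom l v"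
proof -
  have lK: "l \<in> K" using l F_sub by blast
  obtain w where w: "coatom l w" using coatom_ex[OF lK] .
  have uv: "u \<in> V" "v \<in> V" using r unfolding related_def by auto
  have "boolean u" using atom_compl_coatom[OF a w] compl_boolean by blast
  have "\<not> (incomp u v \<and> meet_proper u v)"
  proof
    assume as: "incomp u v \<and> meet_proper u v"
    then obtain k where "k \<in> K" "c k u \<noteq> c k zero" "c k v \<noteq> c k zero"
      unfolding meet_proper_def by blast
    then have "c l v \<noteq> c l zero" using a unfolding atom_def by metis
    then have "c l v = c l unit" using F_bool[OF l V_L[OF uv(2)]] by auto
    then have "u \<le> v" using uv a le_iff[of u v] unfolding atom_def by (auto simp: uv)
    then show False using as unfolding incomp_def by blast
  qed
  then have "compl u v" using r \<open>boolean u\<close> unfolding related_def by blast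
  then have "v = w" using compl_unique[of v w u] atom_compl_coatom[OF a w] uv w
    unfolding coatom_def by auto
  then show ?thesis using w by blast
qed

text \<open>The order dual of the argument for atoms, with the join in place of the meet.\<close>

lemma related_coatom:
  assumes l: "l \<in> F" and a: "coatom l u" and r: "related u v"
  shows "atom l v"
proof -
  have lK: "l \<in> K" using l F_sub by blast
  obtain w where w: "atom l w" using atom_ex[OF lK] .
  have wu: "compl u w" using atom_compl_coatom[OF w a] compl_sym by blast
  have uv: "u \<in> V" "v \<in> V" using r unfolding related_def by auto
  have "boolean u" using wu compl_boolean by blast
  have "\<not> (incomp u v \<and> join_proper u v)"
  proof
    assume as: "incomp u v \<and> join_proper u v"
    then obtain k where "k \<in> K" "c k u \<noteq> c k unit" "c k v \<noteq> c k unit"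
      unfolding join_proper_def by blast
    then have "c l v \<noteq> c l unit" using a unfolding coatom_def by metis
    then have "c l v = c l zero" using F_bool[OF l V_L[OF uv(2)]] by auto
    then have "v \<le> u" using uv a le_iff[of v u] unfolding coatom_def by (auto simp: uv)
    then show False using as unfolding incomp_def by blast
  qed
  then have "compl u v" using r \<open>boolean u\<close> unfolding related_def by blast
  then have "v = w" using compl_unique[of v w u] wu uv w
    unfolding atom_def by auto
  then show ?thesis using w by blast
qed

section \<open>Connectivity of the remaining vertices\<close>

definition H_verts :: "'v set" where
  "H_verts = {u \<in> V. (\<exists>v. related u v) \<and> (\<forall>l\<in>F. \<not> atom l u \<and> \<not> coatom l u)}"

text \<open>No edge leaves \<open>H_verts\<close>: a neighbour that is an atom or coatom of a field
  would force the vertex itself to be a coatom or an atom.\<close>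

lemma H_related: "\<lbrakk>u \<in> H_verts; related u v\<rbrakk> \<Longrightarrow> v \<in> H_verts"
  unfolding H_verts_def using related_atom related_coatom related_sym related_def by blast

text \<open>All vertices in question have an inner value at \<open>i\<close> and lie on one of two
  levels according to \<open>j\<close>. Edges join the levels: a bottom-level \<open>x\<close> and a
  top-level \<open>y\<close> are related iff \<open>c i y < c i x\<close>. On the bottom level a
  larger \<open>i\<close>-value only adds neighbours, on the top level a smaller one does, so two
  vertices of one level share a neighbour.\<close>

lemma two_factor_reach:
  assumes K: "K = {i, j}" and i: "i \<notin> F" and j: "j \<in> F"
    and u: "u \<in> H_verts" and v: "v \<in> H_verts"
  shows "reach u v"
proof -
  have ij: "i \<noteq> j" using i j by auto
  have iK: "i \<in> K" and jK: "j \<in> K" using K by auto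
  have ji: "c j x = c j zero \<or> c j x = c j unit" if "x \<in> L" for x
    using F_bool[OF j that] .
  \<comment> \<open>With an extreme value at \<open>i\<close>, only \<open>zero\<close>,
    \<open>unit\<close>, \<open>atom j\<close> and \<open>coatom j\<close> are possible, and none of
    them belongs to \<open>H_verts\<close>.\<close>
  have H: "x \<in> V \<and> c i x \<noteq> c i zero \<and> c i x \<noteq> c i unit" if "x \<in> H_verts" for x
  proof -
    have x: "x \<in> V" "\<not> atom j x" "\<not> coatom j x" using that j unfolding H_verts_def by auto
    show ?thesis
    proof (rule ccontr)
      assume "\<not> ?thesis"
      then show False
        using x ji[of x] ij K unfolding atom_def coatom_def V_iff by auto
    qed
  qed
  have rel: "related x y \<longleftrightarrow> c i y < c i x"
    if "x \<in> H_verts" "y \<in> H_verts" "c j x = c j zero" "c j y = c j unit" for x y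
  proof -
    have "\<not> boolean x" "\<not> boolean y" using H that iK unfolding boolean_def by blast+
    then have "related x y \<longleftrightarrow> incomp x y" using related_nonboolean H that by blast
    also have "\<dots> \<longleftrightarrow> c i y < c i x"
      using incomp_iff[of x y] H[OF that(1)] H[OF that(2)] that K zero_neq_unit[OF jK]
        c_zero_less[OF jK, of y]
      by auto
    finally show ?thesis .
  qed
  have nbr: "\<exists>y\<in>H_verts. related x y \<and> c j y \<noteq> c j x" if x: "x \<in> H_verts" for x
  proof -
    obtain y where y: "related x y" using x unfolding H_verts_def by blast
    have yH: "y \<in> H_verts" using H_related x y by blast
    have "\<not> boolean x" "\<not> boolean y" using H x yH iK unfolding boolean_def by blast+
    then have "incomp x y" using y related_nonboolean H x yH by blast
    then have "c j y \<noteq> c j x"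
      using incomp_iff[of x y] H[OF x] H[OF yH] K by auto
    then show ?thesis using y yH by blast
  qed
  have tot: "c i x \<le> c i y \<or> c i y \<le> c i x" if "x \<in> H_verts" "y \<in> H_verts" for x y
    using c_total[OF iK] H that V_L by blast
  have same0: "reach x y" if x: "x \<in> H_verts" and y: "y \<in> H_verts"
    and 0: "c j x = c j zero" "c j y = c j zero" and le: "c i x \<le> c i y" for x y
  proof -
    obtain z where z: "z \<in> H_verts" "related x z" "c j z \<noteq> c j x" using nbr[OF x] by blast
    then have zu: "c j z = c j unit" using ji[of z] H[OF z(1)] 0 by auto
    then have "c i z < c i x" using rel[OF x z(1)] z 0 by blast
    then have "related y z" using rel[OF y z(1)] zu 0 le by auto
    then show ?thesis using reach_two_steps z related_sym by blast
  qed
  have same1: "reach x y" if x: "x \<in> H_verts" and y: "y \<in> H_verts"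
    and 1: "c j x = c j unit" "c j y = c j unit" and le: "c i x \<le> c i y" for x y
  proof -
    obtain z where z: "z \<in> H_verts" "related y z" "c j z \<noteq> c j y" using nbr[OF y] by blast
    then have zu: "c j z = c j zero" using ji[of z] H[OF z(1)] 1 by auto
    then have "c i y < c i z" using rel[OF z(1) y] z 1 related_sym by blast
    then have "related z x" using rel[OF z(1) x] zu 1 le by auto
    then show ?thesis using reach_two_steps z related_sym by blast
  qed
  have same: "reach x y" if x: "x \<in> H_verts" and y: "y \<in> H_verts" and eq: "c j x = c j y" for x y
    using same0[OF x y] same0[OF y x] same1[OF x y] same1[OF y x] tot[OF x y] eq reach_sym
      ji[of x] H[OF x] by auto
  show ?thesis
  proof (cases "c j u = c j v")
    case True
    then show ?thesis using same u v by blast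
  next
    case False
    obtain z where z: "z \<in> H_verts" "related u z" "c j z \<noteq> c j u" using nbr[OF u] by blast
    then have "c j z = c j v" using False ji[of z] ji[of u] ji[of v] H z u v by auto
    then have "reach z v" using same z v by blast
    then show ?thesis using z by (meson converse_rtranclp_into_rtranclp)
  qed
qed

lemma many_factors_reach_nonboolean:
  assumes i: "i \<in> K - F" and j: "j1 \<in> K - {i}" "j2 \<in> K - {i}" "j1 \<noteq> j2"
  obtains h where "\<And>u. \<lbrakk>u \<in> V; \<not> boolean u; \<exists>v. related u v\<rbrakk> \<Longrightarrow> reach u h"
proof -
  obtain g where g: "g \<in> L" "c i g \<noteq> c i zero" "c i g \<noteq> c i unit"
    using not_F i by blast
  have iK: "i \<in> K" using i by blast
  txt \<open>
    The elements with \<open>i\<close>-th coordinate strictly between bottom and top, and exactly one other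
    coordinate not bottom (respectively, not top), serve as a connected hub. The non-boolean
    elements comparable to the whole hub are those in \<open>low\<close> and \<open>high\<close>; a neighbour of
    such an element is in neither class, hence it is adjacent to the hub.
  \<close>
  define P where "P = (\<lambda>j u. u \<in> L \<and> (\<forall>k\<in>K. c k u = c k (if k = i then g else if k = j then unit else zero)))"
  define Q where "Q = (\<lambda>j u. u \<in> L \<and> (\<forall>k\<in>K. c k u = c k (if k = i then g else if k = j then zero else unit)))"
  have "\<exists>u. P j u" for j
    using glue[of "\<lambda>k. if k = i then g else if k = j then unit else zero"] g(1)
    unfolding P_def by (metis (full_types) unit_in zero_in)
  then obtain p where p: "\<And>j. P j (p j)" by metis
  have "\<exists>u. Q j u" for j
    using glue[of "\<lambda>k. if k = i then g else if k = j then zero else unit"] g(1)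
    unfolding Q_def by (metis (full_types) unit_in zero_in)
  then obtain q where q: "\<And>j. Q j (q j)" by metis
  have pL: "p j \<in> L" and pi: "c i (p j) = c i g" for j
    using p[of j] iK unfolding P_def by auto
  have pj: "j \<in> K - {i} \<Longrightarrow> c j (p j) = c j unit" for j
    using p[of j] iK unfolding P_def by auto
  have p0: "\<lbrakk>k \<in> K - {i}; k \<noteq> j\<rbrakk> \<Longrightarrow> c k (p j) = c k zero" for j k
    using p[of j] iK unfolding P_def by auto
  have qL: "q j \<in> L" and qi: "c i (q j) = c i g" for j
    using q[of j] iK unfolding Q_def by auto
  have qj: "j \<in> K - {i} \<Longrightarrow> c j (q j) = c j zero" for j
    using q[of j] iK unfolding Q_def by auto
  have q1: "\<lbrakk>k \<in> K - {i}; k \<noteq> j\<rbrakk> \<Longrightarrow> c k (q j) = c k unit" for j k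
    using q[of j] iK unfolding Q_def by auto
  have nb: "\<not> boolean x" if "c i x = c i g" for x
    using that g iK unfolding boolean_def by metis
  have lt: "c k zero < c k unit" if "k \<in> K" for k
    using c_zero_less[OF that unit_in] zero_neq_unit[OF that] by metis
  have pV: "p j \<in> V" and qV: "q j \<in> V" for j
    using not_boolean_V nb pL qL pi qi by blast+
  have pp: "related (p j) (p l)" if "j \<in> K - {i}" "l \<in> K - {i}" "j \<noteq> l" for j l
  proof -
    have "c j (p l) < c j (p j)" using pj[OF that(1)] p0[of j l] lt[of j] that by simp
    moreover have "c l (p j) < c l (p l)" using pj[OF that(2)] p0[of l j] lt[of l] that by simp
    ultimately have "incomp (p j) (p l)" using incomp_iff[OF pL pL] that by blast
    then show ?thesis using related_nonboolean[OF pV pV] nb pi by blast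
  qed
  \<comment> \<open>A second index \<open>l\<close> besides \<open>i\<close> is essential: there
    \<open>p j\<close> is bottom and \<open>q j\<close> is top, whereas at \<open>j\<close> it is
    the other way round.\<close>
  have pq: "related (p j) (q j)" if "j \<in> K - {i}" for j
  proof -
    obtain l where l: "l \<in> K - {i}" "l \<noteq> j" using j by metis
    have "c j (q j) < c j (p j)" using pj[OF that] qj[OF that] lt[of j] that by simp
    moreover have "c l (p j) < c l (q j)" using q1[OF l] p0[OF l] lt[of l] l by simp
    ultimately have "incomp (p j) (q j)" using incomp_iff[OF pL qL] that l by blast
    then show ?thesis using related_nonboolean[OF pV qV] nb pi qi by blast
  qed
  define B where "B = p ` (K - {i}) \<union> q ` (K - {i})"
  have hub: "reach x (p j1)" if "x \<in> B" for x
  proof -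
    have 1: "reach (p l) (p j1)" if "l \<in> K - {i}" for l
      using pp[OF that j(1)] by (cases "l = j1") auto
    have 2: "reach (q l) (p j1)" if "l \<in> K - {i}" for l
      using converse_rtranclp_into_rtranclp[OF related_sym[OF pq[OF that]] 1[OF that]] .
    show ?thesis
      using that 1 2 unfolding B_def by blast
  qed
  define low where "low = (\<lambda>u. c i u \<le> c i g \<and> (\<forall>k\<in>K - {i}. c k u = c k zero))"
  define high where "high = (\<lambda>u. c i g \<le> c i u \<and> (\<forall>k\<in>K - {i}. c k u = c k unit))"
  have far: "(\<exists>x\<in>B. related u x) \<or> low u \<or> high u" if u: "u \<in> V" "\<not> boolean u" for u
  proof (rule ccontr)
    assume no: "\<not> ?thesis"
    have uL: "u \<in> L" using u by simp
    have P: "u \<le> p j \<or> p j \<le> u" and Q: "u \<le> q j \<or> q j \<le> u" if "j \<in> K - {i}" for j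
      using no that u related_nonboolean[OF u(1) pV u(2) nb[OF pi]]
        related_nonboolean[OF u(1) qV u(2) nb[OF qi]]
      unfolding B_def incomp_def by blast+
    have P': "(c i u \<le> c i g \<and> (\<forall>k\<in>K - {i}. k \<noteq> j \<longrightarrow> c k u = c k zero)) \<or>
        (c i g \<le> c i u \<and> c j u = c j unit)" if "j \<in> K - {i}" for j
    proof (cases "u \<le> p j")
      case True
      then have "c k u \<le> c k (p j)" if "k \<in> K" for k using that le_iff[OF uL pL] by blast
      then have "c i u \<le> c i g \<and> (\<forall>k\<in>K - {i}. k \<noteq> j \<longrightarrow> c k u = c k zero)"
        using pi p0 iK uL by (metis Diff_iff c_le_zero)
      then show ?thesis by blast
    next
      case False
      then have "c k (p j) \<le> c k u" if "k \<in> K" for k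
        using that P[OF \<open>j \<in> K - {i}\<close>] le_iff[OF pL uL] by blast
      then have "c i g \<le> c i u \<and> c j u = c j unit"
        using pi pj[OF that] iK that uL by (metis Diff_iff c_unit_le)
      then show ?thesis by blast
    qed
    have Q': "(c i u \<le> c i g \<and> c j u = c j zero) \<or>
        (c i g \<le> c i u \<and> (\<forall>k\<in>K - {i}. k \<noteq> j \<longrightarrow> c k u = c k unit))" if "j \<in> K - {i}" for j
    proof (cases "u \<le> q j")
      case True
      then have "c k u \<le> c k (q j)" if "k \<in> K" for k using that le_iff[OF uL qL] by blast
      then have "c i u \<le> c i g \<and> c j u = c j zero"
        using qi qj[OF that] iK that uL by (metis Diff_iff c_le_zero)
      then show ?thesis by blast
    next
      case False
      then have "c k (q j) \<le> c k u" if "k \<in> K" for k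
        using that Q[OF \<open>j \<in> K - {i}\<close>] le_iff[OF qL uL] by blast
      then have "c i g \<le> c i u \<and> (\<forall>k\<in>K - {i}. k \<noteq> j \<longrightarrow> c k u = c k unit)"
        using qi q1 iK that uL by (metis Diff_iff c_unit_le)
      then show ?thesis by blast
    qed
    \<comment> \<open>A value at \<open>i\<close> different from \<open>g\<close> alone decides the
      direction of every comparison with the hub, and then \<open>u\<close> is low or high.\<close>
    have "c i u = c i g"
    proof (rule ccontr)
      assume ne: "c i u \<noteq> c i g"
      show False
      proof (cases "c i u \<le> c i g")
        case True
        then have "\<not> c i g \<le> c i u" using ne by auto
        then have "low u" unfolding low_def using True Q' by blast
        then show False using no by blast
      next
        case False
        then have "c i g \<le> c i u" using c_total[OF iK uL g(1)] by blast
        then have "high u" unfolding high_def using False P' by blast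
        then show False using no by blast
      qed
    qed
    then have R: "(\<forall>k\<in>K - {i}. k \<noteq> j \<longrightarrow> c k u = c k zero) \<or> c j u = c j unit"
      and S: "c j u = c j zero \<or> (\<forall>k\<in>K - {i}. k \<noteq> j \<longrightarrow> c k u = c k unit)"
      if "j \<in> K - {i}" for j
      using P'[OF that] Q'[OF that] by auto
    \<comment> \<open>With the value \<open>g\<close> at \<open>i\<close>, not being low or high
      means some value off \<open>i\<close> is not bottom and some is not top. Either way
      \<open>R\<close> and \<open>S\<close> force too much: a third coordinate that is both bottom
      and top, or the top at \<open>l\<close>.\<close>
    obtain k l where kl: "k \<in> K - {i}" "c k u \<noteq> c k zero" "l \<in> K - {i}" "c l u \<noteq> c l unit"
      using no \<open>c i u = c i g\<close> unfolding low_def high_def by auto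
    show False
    proof (cases "k = l")
      case True
      obtain m where "m \<in> K - {i}" "m \<noteq> k" using j by metis
      then have "c m u = c m zero" "c m u = c m unit" using R[OF kl(3)] S[OF kl(1)] kl True by auto
      then show False using zero_neq_unit[of m] \<open>m \<in> K - {i}\<close> by simp
    next
      case False
      then have "c l u = c l unit" using S[OF kl(1)] kl by auto
      then show False using kl by blast
    qed
  qed
  have near: "\<exists>x\<in>B. reach u x" if u: "u \<in> V" "\<not> boolean u" and r: "related u v" for u v
  proof (cases "\<exists>x\<in>B. related u x")
    case True
    then show ?thesis by blast
  next
    case False
    have v: "v \<in> V" and uL: "u \<in> L" and vL: "v \<in> L" using r u unfolding related_def by auto
    have inc: "incomp u v" using r u compl_boolean unfolding related_def by blast
    have cmp: "c i v < c i u" "\<not> boolean v" "\<not> low v" "\<not> high v" if lo: "low u"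
    proof -
      have u0: "c k u = c k zero" if "k \<in> K" "k \<noteq> i" for k using lo that unfolding low_def by auto
      show lt: "c i v < c i u"
      proof (rule ccontr)
        assume "\<not> ?thesis"
        then have "c i u \<le> c i v" using c_not_le[OF iK uL vL] by blast
        then have "u \<le> v" using u0 vL uL le_iff[OF uL vL] by (metis c_zero_le)
        then show False using inc incomp_def by blast
      qed
      have gt: "\<not> c i g \<le> c i v" using lt lo unfolding low_def by auto
      then show "\<not> high v" unfolding high_def by blast
      show "\<not> low v"
      proof
        assume "low v"
        then have "c k v \<le> c k u" if "k \<in> K" for k
          using that u0 lt unfolding low_def by (cases "k = i") auto
        then show False using inc le_iff[OF vL uL] unfolding incomp_def by blast
      qed
      \<comment> \<open>A boolean \<open>v\<close> can be related to \<open>u\<close> only through a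
        proper meet. Since \<open>u\<close> is nonzero only at \<open>i\<close>, this would make
        \<open>v\<close> top there, against \<open>c i v < c i u\<close>.\<close>
      show "\<not> boolean v"
      proof
        assume b: "boolean v"
        then obtain k where k: "k \<in> K" "c k u \<noteq> c k zero" "c k v \<noteq> c k zero"
          using r compl_boolean u(2) unfolding related_def meet_proper_def by blast
        then have "k = i" using u0 by blast
        then have "c i v = c i unit" using b k unfolding boolean_def by blast
        then show False using lt c_le_unit[OF iK uL] by auto
      qed
    qed
    \<comment> \<open>The order dual of \<open>cmp\<close>, with joins in place of meets.\<close>
    have cmp': "c i u < c i v" "\<not> boolean v" "\<not> low v" "\<not> high v" if hi: "high u"
    proof -
      have u1: "c k u = c k unit" if "k \<in> K" "k \<noteq> i" for k using hi that unfolding high_def by auto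
      show lt: "c i u < c i v"
      proof (rule ccontr)
        assume "\<not> ?thesis"
        then have "c i v \<le> c i u" using c_not_le[OF iK vL uL] by blast
        then have "v \<le> u" using u1 vL uL le_iff[OF vL uL] by (metis c_le_unit)
        then show False using inc incomp_def by blast
      qed
      have gt: "\<not> c i v \<le> c i g" using lt hi unfolding high_def by auto
      then show "\<not> low v" unfolding low_def by blast
      show "\<not> high v"
      proof
        assume "high v"
        then have "c k u \<le> c k v" if "k \<in> K" for k
          using that u1 lt unfolding high_def by (cases "k = i") auto
        then show False using inc le_iff[OF uL vL] unfolding incomp_def by blast
      qed
      show "\<not> boolean v"
      proof
        assume b: "boolean v"
        then obtain k where k: "k \<in> K" "c k u \<noteq> c k unit" "c k v \<noteq> c k unit"
          using r compl_boolean u(2) unfolding related_def join_proper_def by blast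
        then have "k = i" using u1 by blast
        then have "c i v = c i zero" using b k unfolding boolean_def by blast
        then show False using lt c_zero_le[OF iK uL] by auto
      qed
    qed
    have "low u \<or> high u" using far[OF u] False by blast
    then have "\<not> boolean v" "\<not> low v" "\<not> high v" using cmp cmp' by blast+
    then obtain x where "x \<in> B" "related v x" using far[OF v] by blast
    then show ?thesis using reach_two_steps r by blast
  qed
  show thesis
  proof (rule that[of "p j1"])
    fix u assume "u \<in> V" "\<not> boolean u" "\<exists>v. related u v"
    then show "reach u (p j1)" using near hub by (meson rtranclp_trans)
  qed
qed

text \<open>This links boolean vertices to the hub. One needs a non-field index where
  \<open>u\<close> is top together with two bottom indices, or the dual pattern. Excluding the atoms
  and coatoms of fields, and having three indices, guarantees one of the patterns.\<close>

lemma boolean_related_nonboolean: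
  assumes u: "u \<in> V" "boolean u" and nt: "\<And>l. l \<in> F \<Longrightarrow> \<not> atom l u \<and> \<not> coatom l u"
    and three: "\<And>k l. k \<in> K \<Longrightarrow> l \<in> K \<Longrightarrow> K \<noteq> {k, l}"
  obtains w where "related u w" "\<not> boolean w"
proof -
  note result = that
  have uL: "u \<in> L" using u by simp
  have b: "c k u = c k zero \<or> c k u = c k unit" if "k \<in> K" for k
    using u(2) that unfolding boolean_def by blast
  have lt: "c k zero < c k unit" if "k \<in> K" for k
    using c_zero_less[OF that unit_in] zero_neq_unit[OF that] by metis
  \<comment> \<open>In \<open>w\<close> the inner value at \<open>i\<close> drops below
    \<open>u\<close> and the top at \<open>j\<close> exceeds \<open>u\<close>, so the two are
    incomparable. Index \<open>i\<close> keeps the meet proper and index \<open>l\<close>, bottom in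
    both, keeps the join proper.\<close>
  have one: thesis if i: "i \<in> K - F" "c i u = c i unit"
    and j: "j \<in> K" "c j u = c j zero" and l: "l \<in> K" "c l u = c l zero" "l \<noteq> j" for i j l
  proof -
    obtain g where g: "g \<in> L" "c i g \<noteq> c i zero" "c i g \<noteq> c i unit" using not_F i by blast
    have iK: "i \<in> K" using i by blast
    obtain w where w: "w \<in> L" "\<forall>k\<in>K. c k w = c k (if k = i then g else if k = j then unit else zero)"
      by (rule glueE[of "\<lambda>k. if k = i then g else if k = j then unit else zero"]) (use g in auto)
    have ne: "i \<noteq> j" "i \<noteq> l" using i j l zero_neq_unit[OF iK] by auto
    have wi: "c i w = c i g" and wj: "c j w = c j unit" and wl: "c l w = c l zero"
      using w iK j l ne by auto
    have nb: "\<not> boolean w" using wi g iK unfolding boolean_def by metis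
    have "c i w < c i u" using wi g i c_less_unit[OF iK g(1)] by simp
    moreover have "c j u < c j w" using wj j lt by simp
    ultimately have "incomp u w" using incomp_iff[OF uL w(1)] iK j by blast
    moreover have "meet_proper u w" unfolding meet_proper_def
      using iK i wi g zero_neq_unit[OF iK] by metis
    moreover have "join_proper u w" unfolding join_proper_def
      using l wl zero_neq_unit[OF l(1)] by metis
    ultimately have "related u w" using u not_boolean_V[OF w(1) nb] unfolding related_def by blast
    then show thesis using result nb by blast
  qed
  have two: thesis if i: "i \<in> K - F" "c i u = c i zero"
    and j: "j \<in> K" "c j u = c j unit" and l: "l \<in> K" "c l u = c l unit" "l \<noteq> j" for i j l
  proof -
    obtain g where g: "g \<in> L" "c i g \<noteq> c i zero" "c i g \<noteq> c i unit" using not_F i by blast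
    have iK: "i \<in> K" using i by blast
    obtain w where w: "w \<in> L" "\<forall>k\<in>K. c k w = c k (if k = i then g else if k = j then zero else unit)"
      by (rule glueE[of "\<lambda>k. if k = i then g else if k = j then zero else unit"]) (use g in auto)
    have ne: "i \<noteq> j" "i \<noteq> l" using i j l zero_neq_unit[OF iK] by auto
    have wi: "c i w = c i g" and wj: "c j w = c j zero" and wl: "c l w = c l unit"
      using w iK j l ne by auto
    have nb: "\<not> boolean w" using wi g iK unfolding boolean_def by metis
    have "c i u < c i w" using wi g i c_zero_less[OF iK g(1)] by simp
    moreover have "c j w < c j u" using wj j lt by simp
    ultimately have "incomp u w" using incomp_iff[OF uL w(1)] iK j by blast
    moreover have "join_proper u w" unfolding join_proper_def
      using iK i wi g zero_neq_unit[OF iK] by metis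
    moreover have "meet_proper u w" unfolding meet_proper_def
      using l wl zero_neq_unit[OF l(1)] by metis
    ultimately have "related u w" using u not_boolean_V[OF w(1) nb] unfolding related_def by blast
    then show thesis using result nb by blast
  qed
  obtain a where a: "a \<in> K" "c a u = c a unit" using u V_iff b by metis
  obtain z where z: "z \<in> K" "c z u = c z zero" using u V_iff b by metis
  show thesis
  proof (cases "\<exists>k\<in>K - {z}. c k u = c k zero")
    case True
    then obtain y where y: "y \<in> K" "y \<noteq> z" "c y u = c y zero" by blast
    show thesis
    proof (cases "\<exists>i\<in>K - F. c i u = c i unit")
      case True
      then show thesis using one y z by blast
    next
      case False
      obtain i where i: "i \<in> K - F" using not_all_F F_sub by blast
      then have i0: "c i u = c i zero" using False b by blast
      \<comment> \<open>All non-field coordinates are bottom here, so \<open>u\<close> is top only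
        at field indices. As it is not an atom, it has a second top coordinate, and the dual pattern
        applies.\<close>
      have "a \<in> F" using a False by blast
      moreover have "\<not> atom a u" using nt calculation by blast
      ultimately obtain k where "k \<in> K" "k \<noteq> a" "c k u \<noteq> c k zero"
        using a uL unfolding atom_def by (auto split: if_splits)
      then show thesis using two[OF i i0 a, of k] b by blast
    qed
  next
    case False
    then have others: "c k u = c k unit" if "k \<in> K" "k \<noteq> z" for k using b that by blast
    then have "coatom z u" using z uL unfolding coatom_def by auto
    then have "z \<in> K - F" using nt z by blast
    \<comment> \<open>Here \<open>u\<close> is the coatom of the non-field index \<open>z\<close>.
      The third index supplies the second top coordinate of the dual pattern.\<close>
    moreover obtain k where "k \<in> K" "k \<noteq> z" "k \<noteq> a"
      using three[OF a(1) z(1)] a z by blast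
    ultimately show thesis using two[of z a k] z a others by blast
  qed
qed

text \<open>A boolean vertex first steps to a non-boolean neighbour, and from there to the hub
  vertex \<open>h\<close>. With two indices neither of these lemmas applies.\<close>

lemma H_reach:
  assumes u: "u \<in> H_verts" and v: "v \<in> H_verts"
  shows "reach u v"
proof -
  obtain i where i: "i \<in> K - F" using not_all_F F_sub by blast
  obtain j where j: "j \<in> F" using F_nonempty by blast
  have ij: "i \<in> K" "j \<in> K" "i \<noteq> j" using i j F_sub by auto
  show ?thesis
  proof (cases "K = {i, j}")
    case True
    then show ?thesis using two_factor_reach i j u v by blast
  next
    case False
    then obtain l where l: "l \<in> K" "l \<noteq> i" "l \<noteq> j" using ij by blast
    obtain h where h: "\<And>u. \<lbrakk>u \<in> V; \<not> boolean u; \<exists>v. related u v\<rbrakk> \<Longrightarrow> reach u h"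
      using many_factors_reach_nonboolean[OF i, of j l] ij l by blast
    have three: "K \<noteq> {k, m}" for k m using ij l by auto
    have "reach x h" if x: "x \<in> H_verts" for x
    proof (cases "boolean x")
      case True
      obtain w where w: "related x w" "\<not> boolean w"
        using boolean_related_nonboolean[OF _ True _ three] x unfolding H_verts_def by blast
      then have "w \<in> V" "related w x" using related_sym unfolding related_def by blast+
      then have "reach w h" using h w by blast
      then show ?thesis using w by (meson converse_rtranclp_into_rtranclp)
    next
      case False
      then show ?thesis using x h unfolding H_verts_def by blast
    qed
    then show ?thesis using u v reach_sym by (meson rtranclp_trans)
  qed
qed

section \<open>The graph \<open>H\<close> and the decomposition of the strong resolving
  graph\<close>

definition H :: "'v pair_pre_digraph" where
  "H = \<lparr>pverts = H_verts, parcs = {(u, v). u \<in> H_verts \<and> related u v}\<rparr>"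

lemma H_simps [simp]:
  "pverts H = H_verts" "(u, v) \<in> parcs H \<longleftrightarrow> u \<in> H_verts \<and> related u v"
  by (auto simp: H_def)

lemma related_irrefl: "\<not> related u u"
  using compl_incomp unfolding related_def incomp_def by blast

lemma H_bidirected: "pair_bidirected_digraph H"
  by unfold_locales
    (auto simp: symmetric_def sym_def related_irrefl intro: H_related related_sym)

text \<open>The empty case does occur: for a three-element and a two-element chain, the two vertices
  with the inner value are comparable to each other and related to nothing.\<close>

lemma H_connected: "connected_or_null H"
proof -
  have "(u, v) \<in> rtrancl_on H_verts ((parcs H)\<^sup>s)" if u: "u \<in> H_verts" and v: "v \<in> H_verts" for u v
    using H_reach[OF u v] u
  proof (induction rule: converse_rtranclp_induct)
    case base
    then show ?case by (simp add: v)
  next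
    case (step y z)
    then have "z \<in> H_verts" using H_related by blast
    then show ?case using step
      by (intro converse_rtrancl_on_into_rtrancl_on[of y z]) (auto simp: symcl_def)
  qed
  then show ?thesis
    unfolding connected_or_null_def connected_conv by auto
qed

lemma strong_resolving_graph_iso:
  assumes fin: "finite F"
  shows "digraph_iso (with_proj (strong_resolving_graph G))
    (with_proj (disjoint_graph_union H (graph_copies (card F) (complete_graph 2))))"
proof -
  have SR: "pverts (strong_resolving_graph G) = {u. \<exists>v. related u v}"
    "parcs (strong_resolving_graph G) = {(u, v). related u v}"
    by (auto simp: strong_resolving_graph_def mmd_iff related_def)
  have FK: "l \<in> K" if "l \<in> F" for l using that F_sub by blast
  obtain i where i: "i \<in> K - F" using not_all_F F_sub by blast
  have "\<exists>u. atom l u" "\<exists>u. coatom l u" if "l \<in> F" for l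
    using atom_ex[OF FK[OF that]] coatom_ex[OF FK[OF that]] by metis+
  then obtain a b where a: "\<And>l. l \<in> F \<Longrightarrow> atom l (a l)" and b: "\<And>l. l \<in> F \<Longrightarrow> coatom l (b l)"
    by metis
  \<comment> \<open>\<open>graph_copies\<close> numbers its copies from 1, and so must the
    enumeration of \<open>F\<close>.\<close>
  obtain e where e: "bij_betw e F {1..card F}"
    using ex_bij_betw_finite_nat[OF fin] by (metis bij_betw_iff_card fin finite_atLeastAtMost card_atLeastAtMost diff_Suc_1)
  have atom_inj: "l = l'" if "l \<in> F" "l' \<in> F" "atom l u" "atom l' u" for l l' u
    using that FK zero_neq_unit unfolding atom_def by metis
  have coatom_inj: "l = l'" if "l \<in> F" "l' \<in> F" "coatom l u" "coatom l' u" for l l' u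
    using that FK zero_neq_unit unfolding coatom_def by metis
  \<comment> \<open>The non-field index \<open>i\<close> separates the copies: an atom of a field is
    bottom there, a coatom is top.\<close>
  have atom_coatom: "\<not> (atom l u \<and> coatom l' u)" if "l \<in> F" "l' \<in> F" for l l' u
  proof
    assume "atom l u \<and> coatom l' u"
    moreover have "i \<noteq> l" "i \<noteq> l'" using i that by auto
    ultimately show False
      using i zero_neq_unit[of i] unfolding atom_def coatom_def by auto
  qed
  have atom_a: "atom l u \<longleftrightarrow> u = a l" if "l \<in> F" for l u
    using a[OF that] eq_iff unfolding atom_def by metis
  have coatom_b: "coatom l u \<longleftrightarrow> u = b l" if "l \<in> F" for l u
    using b[OF that] eq_iff unfolding coatom_def by metis
  have rel_ab: "related (a l) (b l)" if "l \<in> F" for l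
    using atom_compl_coatom[OF a b] atom_V[OF FK a] coatom_V[OF FK b] that unfolding related_def by blast
  \<comment> \<open>The index in \<open>F\<close> is recovered from the vertex;
    \<open>atom_inj\<close> and \<open>coatom_inj\<close> make the descriptions unique, and
    \<open>atom_coatom\<close> makes the order of the first two cases irrelevant.\<close>
  define f :: "'v \<Rightarrow> 'v + nat \<times> nat" where
    "f = (\<lambda>u. if \<exists>l\<in>F. atom l u then Inr (e (THE l. l \<in> F \<and> atom l u), 0)
      else if \<exists>l\<in>F. coatom l u then Inr (e (THE l. l \<in> F \<and> coatom l u), 1) else Inl u)"
  have fa: "f (a l) = Inr (e l, 0)" if l: "l \<in> F" for l
  proof -
    have "(THE k. k \<in> F \<and> atom k (a l)) = l"
      using a[OF l] l atom_inj by (intro the_equality) auto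
    then show ?thesis using a[OF l] l unfolding f_def by auto
  qed
  have fb: "f (b l) = Inr (e l, 1)" if l: "l \<in> F" for l
  proof -
    have "(THE k. k \<in> F \<and> coatom k (b l)) = l"
      using b[OF l] l coatom_inj by (intro the_equality) auto
    then show ?thesis using b[OF l] l atom_coatom unfolding f_def by auto
  qed
  have fH: "f u = Inl u" if "u \<in> H_verts" for u
    using that unfolding f_def H_verts_def by auto
  have verts: "{u. \<exists>v. related u v} = H_verts \<union> a ` F \<union> b ` F"
  proof
    show "{u. \<exists>v. related u v} \<subseteq> H_verts \<union> a ` F \<union> b ` F"
      using atom_a coatom_b unfolding H_verts_def related_def by blast
    show "H_verts \<union> a ` F \<union> b ` F \<subseteq> {u. \<exists>v. related u v}"
      using rel_ab related_sym unfolding H_verts_def by blast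
  qed
  have arcs: "{(u, v). related u v} =
    {(u, v). u \<in> H_verts \<and> related u v} \<union> (\<lambda>l. (a l, b l)) ` F \<union> (\<lambda>l. (b l, a l)) ` F"
  proof
    show "{(u, v). related u v} \<subseteq>
      {(u, v). u \<in> H_verts \<and> related u v} \<union> (\<lambda>l. (a l, b l)) ` F \<union> (\<lambda>l. (b l, a l)) ` F"
      (is "_ \<subseteq> ?A")
    proof (rule subrelI)
      fix u v assume "(u, v) \<in> {(u, v). related u v}"
      then have r: "related u v" by simp
      then consider "u \<in> H_verts" | l where "l \<in> F" "u = a l" | l where "l \<in> F" "u = b l"
        using verts by blast
      then show "(u, v) \<in> ?A"
      proof cases
        case 1
        then show ?thesis using r by blast
      next
        case 2
        then have "v = b l" using related_atom[OF 2(1), of u v] r atom_a coatom_b by blast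
        then show ?thesis using 2 by blast
      next
        case 3
        then have "v = a l" using related_coatom[OF 3(1), of u v] r atom_a coatom_b by blast
        then show ?thesis using 3 by blast
      qed
    qed
  qed (use rel_ab related_sym in auto)
  have eF: "e ` F = {1..card F}" and einj: "inj_on e F"
    using e unfolding bij_betw_def by auto
  show ?thesis
  proof (rule digraph_isoI[where f = f])
    show "pair_wf_digraph (strong_resolving_graph G)"
      by unfold_locales (auto simp: SR, blast dest: related_sym)
    show "inj_on f (pverts (strong_resolving_graph G))"
      unfolding SR verts inj_on_def using einj fH fa fb by (auto dest: inj_onD)
    have two: "{..<2::nat} = {0, 1}" by auto
    show "pverts (disjoint_graph_union H (graph_copies (card F) (complete_graph 2))) =
      f ` pverts (strong_resolving_graph G)"
    proof -
      have "f ` H_verts = Inl ` H_verts" using fH by (auto simp: image_iff)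
      moreover have "f ` a ` F = Inr ` (\<lambda>x. (x, 0)) ` e ` F" 
        unfolding image_image by (intro image_cong) (auto simp: fa)
      moreover have "f ` b ` F = Inr ` (\<lambda>x. (x, 1)) ` e ` F" 
        unfolding image_image by (intro image_cong) (auto simp: fb)
      ultimately have "f ` pverts (strong_resolving_graph G) =
        Inl ` H_verts \<union> Inr ` (\<lambda>x. (x, 0)) ` {1..card F} \<union> Inr ` (\<lambda>x. (x, 1)) ` {1..card F}"
        unfolding SR verts image_Un eF by simp
      also have "\<dots> = H_verts <+> {1..card F} \<times> {0, 1}" by auto
      finally show ?thesis
        by (simp add: disjoint_graph_union_def graph_copies_def complete_graph_def two)
    qed
    show "parcs (disjoint_graph_union H (graph_copies (card F) (complete_graph 2))) =
      map_prod f f ` parcs (strong_resolving_graph G)"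
    proof -
      have "map_prod f f ` {(u, v). u \<in> H_verts \<and> related u v} =
          map_prod Inl Inl ` {(u, v). u \<in> H_verts \<and> related u v}"
        using fH H_related by (intro image_cong) auto
      moreover have "map_prod f f ` (\<lambda>l. (a l, b l)) ` F = (\<lambda>x. (Inr (x, 0), Inr (x, 1))) ` e ` F"
        unfolding image_image by (intro image_cong) (auto simp: fa fb)
      moreover have "map_prod f f ` (\<lambda>l. (b l, a l)) ` F = (\<lambda>x. (Inr (x, 1), Inr (x, 0))) ` e ` F"
        unfolding image_image by (intro image_cong) (auto simp: fa fb)
      ultimately have "map_prod f f ` parcs (strong_resolving_graph G) =
        map_prod Inl Inl ` {(u, v). u \<in> H_verts \<and> related u v} \<union>
        (\<lambda>x. (Inr (x, 0), Inr (x, 1))) ` {1..card F} \<union> (\<lambda>x. (Inr (x, 1), Inr (x, 0))) ` {1..card F}"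
        unfolding SR arcs image_Un eF by simp
      also have "\<dots> = {(Inl u, Inl v) |u v. u \<in> H_verts \<and> related u v} \<union>
          {(Inr p, Inr q) |p q. \<exists>k x y. p = (k, x) \<and> q = (k, y) \<and> k \<in> {1..card F} \<and> x < 2 \<and> y < 2 \<and> x \<noteq> y}"
        (is "_ = _ \<union> ?K")
      proof -
        have "?K = {(Inr (k, x), Inr (k, y)) |k x y. k \<in> {1..card F} \<and> (x = 0 \<and> y = 1 \<or> x = 1 \<and> y = 0)}"
          by fastforce
        also have "\<dots> = (\<lambda>x. (Inr (x, 0), Inr (x, 1))) ` {1..card F} \<union>
            (\<lambda>x. (Inr (x, 1), Inr (x, 0))) ` {1..card F}"
          by (auto simp: image_iff)
        finally show ?thesis by (auto simp: image_iff)
      qed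
      finally show ?thesis
        by (simp add: disjoint_graph_union_def graph_copies_def complete_graph_def) 
    qed
  qed
qed

end

section \<open>Ideals of a product of rings\<close>

lemma (in cring) nonunit_in_maximalideal:
  assumes x: "x \<in> carrier R" "x \<notin> Units R"
  obtains M where "maximalideal M R" "x \<in> M"
proof -
  define P where "P = {I. ideal I R \<and> x \<in> I \<and> \<one> \<notin> I}"
  have start: "PIdl x \<in> P"
    unfolding P_def using x cgenideal_ideal[OF x(1)] cgenideal_self[OF x(1)]
    by (auto simp: cgenideal_def Units_def m_comm)
  have "\<exists>U\<in>P. \<forall>X\<in>C. X \<subseteq> U" if C: "subset.chain P C" for C
  proof (cases "C = {}")
    case False
    have "subset.chain {I. ideal I R} C"
      using C unfolding pred_on.chain_def P_def by auto
    then have "ideal (\<Union>C) R"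
      using chain_Union_is_ideal[of C] False by simp
    moreover have "x \<in> \<Union>C" "\<one> \<notin> \<Union>C"
      using C False unfolding pred_on.chain_def P_def by auto
    ultimately have "\<Union>C \<in> P" unfolding P_def by blast
    then show ?thesis by blast
  qed (use start in auto)
  from subset_Zorn[OF this] obtain M where M: "M \<in> P" "\<forall>X\<in>P. M \<subseteq> X \<longrightarrow> X = M"
    by blast
  have "maximalideal M R"
  proof (rule maximalidealI)
    show "ideal M R" "carrier R \<noteq> M" using M unfolding P_def by auto
    fix J assume J: "ideal J R" "M \<subseteq> J" "J \<subseteq> carrier R"
    show "J = M \<or> J = carrier R"
    proof (cases "\<one> \<in> J")
      case True
      then show ?thesis using ideal.one_imp_carrier[OF J(1)] by blast
    next
      case False
      then have "J \<in> P" using M J unfolding P_def by blast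
      then show ?thesis using M J by blast
    qed
  qed
  then show thesis using that M unfolding P_def by blast
qed

text \<open>Every element is a unit times a power of a generator \<open>p\<close> of the maximal
  ideal, so the one with the smaller exponent divides the other.\<close>

lemma (in local_artinian_pir) dvd_total:
  assumes a: "a \<in> carrier R" and b: "b \<in> carrier R"
  shows "(\<exists>r\<in>carrier R. r \<otimes> a = b) \<or> (\<exists>r\<in>carrier R. r \<otimes> b = a)"
proof -
  obtain M where M: "maximalideal M R" "\<And>M'. maximalideal M' R \<Longrightarrow> M' = M"
    using unique_maximalideal by blast
  interpret M: maximalideal M R by fact
  have unit: "x \<in> Units R" if "x \<in> carrier R" "x \<notin> M" for x
    using nonunit_in_maximalideal[OF that(1)] M(2) that(2) by metis
  obtain p where p: "p \<in> carrier R" "M = PIdl p"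
    using every_ideal_principal[OF M.is_ideal] cgenideal_eq_genideal
    unfolding principalideal_def principalideal_axioms_def by auto
  have pM: "p \<in> M" using p cgenideal_self by simp
  have pc: "p [^] k \<in> carrier R" for k :: nat using p by simp
  have "PIdl (p [^] Suc k) \<subseteq> PIdl (p [^] k)" for k :: nat
  proof -
    have "p [^] Suc k = p \<otimes> p [^] k" using p m_comm[OF pc p(1)] by simp
    then have "p [^] Suc k \<in> PIdl (p [^] k)" using p unfolding cgenideal_def by blast
    then show ?thesis using cgenideal_minimal cgenideal_ideal pc by blast
  qed
  then obtain N :: nat where N: "\<forall>k\<ge>N. PIdl (p [^] k) = PIdl (p [^] N)"
    using descending_chain_condition[of "\<lambda>k. PIdl (p [^] k)"] cgenideal_ideal pc by blast
  \<comment> \<open>Nakayama for a principal ideal: the stationary chain gives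
    \<open>p^N = r p^(N+1)\<close>, so \<open>(1 - r p) p^N = 0\<close>. Since \<open>r p\<close>
    lies in \<open>M\<close>, the factor \<open>1 - r p\<close> does not and is a unit.\<close>
  have nil: "p [^] N = \<zero>"
  proof -
    have "p [^] N \<in> PIdl (p [^] Suc N)"
      using N[rule_format, of "Suc N"] cgenideal_self[OF pc[of N]] by simp
    then obtain r where r: "r \<in> carrier R" "p [^] N = r \<otimes> p [^] Suc N"
      unfolding cgenideal_def by blast
    have rp: "r \<otimes> p \<in> M" using r pM M.I_l_closed by blast
    have c: "\<one> \<ominus> r \<otimes> p \<in> carrier R" using r p by simp
    have "\<one> \<ominus> r \<otimes> p \<notin> M"
    proof
      assume "\<one> \<ominus> r \<otimes> p \<in> M"
      then have "(\<one> \<ominus> r \<otimes> p) \<oplus> r \<otimes> p \<in> M" using rp M.a_closed by blast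
      moreover have "(\<one> \<ominus> r \<otimes> p) \<oplus> r \<otimes> p = \<one>" using r p by algebra
      ultimately show False using M.one_imp_carrier M.I_notcarr by simp
    qed
    then have u: "\<one> \<ominus> r \<otimes> p \<in> Units R" using unit c by blast
    have "(\<one> \<ominus> r \<otimes> p) \<otimes> p [^] N = p [^] N \<ominus> r \<otimes> (p [^] N \<otimes> p)"
      using r(1) p(1) pc[of N] by algebra
    also have "\<dots> = \<zero>" using r pc by (simp add: r_right_minus_eq)
    finally have eq: "(\<one> \<ominus> r \<otimes> p) \<otimes> p [^] N = \<zero>" .
    have "p [^] N = (inv (\<one> \<ominus> r \<otimes> p) \<otimes> (\<one> \<ominus> r \<otimes> p)) \<otimes> p [^] N"
      using u pc by simp
    also have "\<dots> = inv (\<one> \<ominus> r \<otimes> p) \<otimes> ((\<one> \<ominus> r \<otimes> p) \<otimes> p [^] N)"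
      using u c pc by (intro m_assoc) auto
    also have "\<dots> = \<zero>" unfolding eq using u by simp
    finally show ?thesis .
  qed
  \<comment> \<open>If \<open>x\<close> had no such form, every cofactor would lie in
    \<open>M\<close> and could be divided by \<open>p\<close> once more. After \<open>N\<close>
    rounds \<open>x\<close> would be zero, but zero has the form \<open>1 p^N\<close>.\<close>
  have form: "\<exists>k::nat. \<exists>u\<in>Units R. x = u \<otimes> p [^] k" if x: "x \<in> carrier R" for x
  proof (rule ccontr)
    assume no: "\<not> ?thesis"
    have "\<exists>y\<in>carrier R. x = y \<otimes> p [^] k" for k :: nat
    proof (induction k)
      case 0
      then show ?case using x by auto
    next
      case (Suc k)
      then obtain y where y: "y \<in> carrier R" "x = y \<otimes> p [^] k" by blast
      then have "y \<in> M" using no unit by blast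
      then obtain z where z: "z \<in> carrier R" "y = z \<otimes> p" unfolding p(2) cgenideal_def by blast
      have "x = z \<otimes> (p \<otimes> p [^] k)"
        unfolding y(2) z(2) by (rule m_assoc[OF z(1) p(1) pc])
      also have "p \<otimes> p [^] k = p [^] Suc k"
        using m_comm[OF p(1) pc] by (simp only: nat_pow_Suc)
      finally have "x = z \<otimes> p [^] Suc k" .
      then show ?case using z by blast
    qed
    from this[of N] have "x = \<zero>" using nil by auto
    then have "x = \<one> \<otimes> p [^] N" using nil by simp
    then show False using no by blast
  qed
  obtain k u where u: "u \<in> Units R" "a = u \<otimes> p [^] (k::nat)" using form[OF a] by blast
  obtain l v where v: "v \<in> Units R" "b = v \<otimes> p [^] (l::nat)" using form[OF b] by blast
  have div: "\<exists>r\<in>carrier R. r \<otimes> (x \<otimes> p [^] m) = y \<otimes> p [^] n"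
    if "m \<le> n" "x \<in> Units R" "y \<in> Units R" for m n :: nat and x y
  proof
    let ?i = "inv x"
    have i: "?i \<in> carrier R" "?i \<otimes> x = \<one>" "x \<in> carrier R" "y \<in> carrier R" using that by auto
    let ?r = "y \<otimes> ?i \<otimes> p [^] (n - m)"
    show "?r \<in> carrier R" using i pc by simp
    have "?r \<otimes> (x \<otimes> p [^] m) = y \<otimes> (?i \<otimes> x) \<otimes> (p [^] (n - m) \<otimes> p [^] m)"
      using i(1,3,4) pc by (simp only: m_ac m_closed)
    also have "\<dots> = y \<otimes> p [^] n"
      using i that(1) p(1) by (simp add: nat_pow_mult)
    finally show "?r \<otimes> (x \<otimes> p [^] m) = y \<otimes> p [^] n" .
  qed
  show ?thesis
    using div[of k l u v] div[of l k v u] u v by (cases "k \<le> l") auto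
qed

section \<open>Decomposition by orthogonal idempotents and the ideal lattice\<close>

definition chain_idem :: "('a, 'm) ring_scheme \<Rightarrow> 'a \<Rightarrow> bool" where
  "chain_idem R e \<longleftrightarrow> e \<in> carrier R \<and> e \<otimes>\<^bsub>R\<^esub> e = e \<and> e \<noteq> \<zero>\<^bsub>R\<^esub> \<and>
     (\<forall>a\<in>carrier R. \<forall>b\<in>carrier R.
        (\<exists>r\<in>carrier R. r \<otimes>\<^bsub>R\<^esub> (e \<otimes>\<^bsub>R\<^esub> a) = e \<otimes>\<^bsub>R\<^esub> b) \<or> (\<exists>r\<in>carrier R. r \<otimes>\<^bsub>R\<^esub> (e \<otimes>\<^bsub>R\<^esub> b) = e \<otimes>\<^bsub>R\<^esub> a))"

text \<open>For a nonzero idempotent \<open>e\<close> of a commutative ring this says that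
  \<open>eR\<close> is a field; the multiplier \<open>r\<close> may range over all of
  \<open>R\<close> because it acts on \<open>eR\<close> as \<open>er\<close> does.\<close>

definition field_idem :: "('a, 'm) ring_scheme \<Rightarrow> 'a \<Rightarrow> bool" where
  "field_idem R e \<longleftrightarrow>
     (\<forall>a\<in>carrier R. e \<otimes>\<^bsub>R\<^esub> a = \<zero>\<^bsub>R\<^esub> \<or> (\<exists>r\<in>carrier R. r \<otimes>\<^bsub>R\<^esub> (e \<otimes>\<^bsub>R\<^esub> a) = e))"

text \<open>The factors have different types, so each is represented inside one ring by its
  idempotent. The last clause is completeness: it amounts to the idempotents summing to one, but
  avoids finite sums.\<close>

definition chain_decomp :: "('a, 'm) ring_scheme \<Rightarrow> 'a set \<Rightarrow> bool" where
  "chain_decomp R E \<longleftrightarrow> finite E \<and> (\<forall>e\<in>E. chain_idem R e) \<and>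
     (\<forall>e\<in>E. \<forall>f\<in>E. e \<noteq> f \<longrightarrow> e \<otimes>\<^bsub>R\<^esub> f = \<zero>\<^bsub>R\<^esub>) \<and>
     (\<forall>x\<in>carrier R. (\<forall>e\<in>E. e \<otimes>\<^bsub>R\<^esub> x = \<zero>\<^bsub>R\<^esub>) \<longrightarrow> x = \<zero>\<^bsub>R\<^esub>)"

lemma chain_idem_carrier: "chain_idem R e \<Longrightarrow> e \<in> carrier R"
  by (simp add: chain_idem_def)

lemma chain_decomp_iso:
  assumes R: "ring R" and S: "ring S" and h: "h \<in> ring_iso R S" and E: "chain_decomp R E"
  shows "chain_decomp S (h ` E)" "inj_on h E" "\<And>e. e \<in> E \<Longrightarrow> field_idem S (h e) \<longleftrightarrow> field_idem R e"
proof -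
  interpret R: ring R by fact
  interpret S: ring S by fact
  note hm = ring_iso_memE[OF h]
  have car: "carrier S = h ` carrier R" and inj: "inj_on h (carrier R)"
    using hm(5) unfolding bij_betw_def by auto
  have z: "h \<zero>\<^bsub>R\<^esub> = \<zero>\<^bsub>S\<^esub>"
    using h R S unfolding ring_iso_def by (intro ring_hom_zero) auto
  have eq: "h x = h y \<longleftrightarrow> x = y" if "x \<in> carrier R" "y \<in> carrier R" for x y
    using inj that by (auto dest: inj_onD)
  have EC: "E \<subseteq> carrier R" using E unfolding chain_decomp_def chain_idem_def by auto
  then show "inj_on h E" using inj inj_on_subset by blast
  have chain: "chain_idem S (h e)" if "chain_idem R e" for e
    using that unfolding chain_idem_def car
    by (auto simp: hm(2)[symmetric] z[symmetric] eq)
  show "field_idem S (h e) \<longleftrightarrow> field_idem R e" if "e \<in> E" for e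
    using that EC unfolding field_idem_def car
    by (auto simp: hm(2)[symmetric] z[symmetric] eq subset_iff)
  have "\<forall>x\<in>carrier R. (\<forall>e\<in>E. h e \<otimes>\<^bsub>S\<^esub> h x = \<zero>\<^bsub>S\<^esub>) \<longrightarrow> h x = \<zero>\<^bsub>S\<^esub>"
    using E EC unfolding chain_decomp_def
    by (auto simp: hm(2)[symmetric] z[symmetric] eq subset_iff)
  moreover have "\<forall>e\<in>E. \<forall>f\<in>E. h e \<noteq> h f \<longrightarrow> h e \<otimes>\<^bsub>S\<^esub> h f = \<zero>\<^bsub>S\<^esub>"
    using E EC unfolding chain_decomp_def
    by (auto simp: hm(2)[symmetric] z[symmetric] eq subset_iff)
  ultimately show "chain_decomp S (h ` E)"
    using E chain unfolding chain_decomp_def car by auto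
qed

lemma RDirProd_simps:
  "carrier (RDirProd R S) = carrier R \<times> carrier S" "\<zero>\<^bsub>RDirProd R S\<^esub> = (\<zero>\<^bsub>R\<^esub>, \<zero>\<^bsub>S\<^esub>)"
  "(a, b) \<otimes>\<^bsub>RDirProd R S\<^esub> (c, d) = (a \<otimes>\<^bsub>R\<^esub> c, b \<otimes>\<^bsub>S\<^esub> d)"
  by (simp_all add: RDirProd_def DirProd_def monoid.defs)

text \<open>Between pairs with a zero in the same component, divisibility is that of the other
  factor (\<open>div1\<close>, \<open>div2\<close>).\<close>

lemma idem_RDirProd:
  assumes "ring R" "ring S"
  shows "chain_idem R e \<Longrightarrow> chain_idem (RDirProd R S) (e, \<zero>\<^bsub>S\<^esub>)"
    and "chain_idem S f \<Longrightarrow> chain_idem (RDirProd R S) (\<zero>\<^bsub>R\<^esub>, f)"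
    and "field_idem (RDirProd R S) (e, \<zero>\<^bsub>S\<^esub>) \<longleftrightarrow> field_idem R e"
    and "field_idem (RDirProd R S) (\<zero>\<^bsub>R\<^esub>, f) \<longleftrightarrow> field_idem S f"
proof -
  interpret R: ring R by fact
  interpret S: ring S by fact
  have div1: "(\<exists>p\<in>carrier (RDirProd R S). p \<otimes>\<^bsub>RDirProd R S\<^esub> (x, \<zero>\<^bsub>S\<^esub>) = (y, \<zero>\<^bsub>S\<^esub>)) \<longleftrightarrow>
      (\<exists>r\<in>carrier R. r \<otimes>\<^bsub>R\<^esub> x = y)" for x y
    by (auto simp: RDirProd_simps)
  have div2: "(\<exists>p\<in>carrier (RDirProd R S). p \<otimes>\<^bsub>RDirProd R S\<^esub> (\<zero>\<^bsub>R\<^esub>, x) = (\<zero>\<^bsub>R\<^esub>, y)) \<longleftrightarrow>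
      (\<exists>r\<in>carrier S. r \<otimes>\<^bsub>S\<^esub> x = y)" for x y
    by (auto simp: RDirProd_simps)
  have mult1: "(e, \<zero>\<^bsub>S\<^esub>) \<otimes>\<^bsub>RDirProd R S\<^esub> p = (e \<otimes>\<^bsub>R\<^esub> fst p, \<zero>\<^bsub>S\<^esub>)"
    if "p \<in> carrier (RDirProd R S)" for p
    using that by (cases p) (simp add: RDirProd_simps)
  have mult2: "(\<zero>\<^bsub>R\<^esub>, f) \<otimes>\<^bsub>RDirProd R S\<^esub> p = (\<zero>\<^bsub>R\<^esub>, f \<otimes>\<^bsub>S\<^esub> snd p)"
    if "p \<in> carrier (RDirProd R S)" for p
    using that by (cases p) (simp add: RDirProd_simps)
  have proj: "fst p \<in> carrier R" "snd p \<in> carrier S" if "p \<in> carrier (RDirProd R S)" for p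
    using that by (auto simp: RDirProd_simps)
  have ball1: "(\<forall>p\<in>carrier (RDirProd R S). P (fst p)) \<longleftrightarrow> (\<forall>a\<in>carrier R. P a)" for P
    using S.zero_closed by (auto simp: RDirProd_simps)
  have ball2: "(\<forall>p\<in>carrier (RDirProd R S). P (snd p)) \<longleftrightarrow> (\<forall>b\<in>carrier S. P b)" for P
    using R.zero_closed by (auto simp: RDirProd_simps)
  show "chain_idem (RDirProd R S) (e, \<zero>\<^bsub>S\<^esub>)" if e: "chain_idem R e"
    unfolding chain_idem_def
  proof (intro conjI ballI)
    fix p q assume pq: "p \<in> carrier (RDirProd R S)" "q \<in> carrier (RDirProd R S)"
    show "(\<exists>r\<in>carrier (RDirProd R S). r \<otimes>\<^bsub>RDirProd R S\<^esub> ((e, \<zero>\<^bsub>S\<^esub>) \<otimes>\<^bsub>RDirProd R S\<^esub> p) = (e, \<zero>\<^bsub>S\<^esub>) \<otimes>\<^bsub>RDirProd R S\<^esub> q) \<or>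
      (\<exists>r\<in>carrier (RDirProd R S). r \<otimes>\<^bsub>RDirProd R S\<^esub> ((e, \<zero>\<^bsub>S\<^esub>) \<otimes>\<^bsub>RDirProd R S\<^esub> q) = (e, \<zero>\<^bsub>S\<^esub>) \<otimes>\<^bsub>RDirProd R S\<^esub> p)"
      unfolding mult1[OF pq(1)] mult1[OF pq(2)] div1
      using e proj(1)[OF pq(1)] proj(1)[OF pq(2)] unfolding chain_idem_def by blast
  qed (use e in \<open>auto simp: chain_idem_def RDirProd_simps\<close>)
  show "chain_idem (RDirProd R S) (\<zero>\<^bsub>R\<^esub>, f)" if f: "chain_idem S f"
    unfolding chain_idem_def
  proof (intro conjI ballI)
    fix p q assume pq: "p \<in> carrier (RDirProd R S)" "q \<in> carrier (RDirProd R S)"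
    show "(\<exists>r\<in>carrier (RDirProd R S). r \<otimes>\<^bsub>RDirProd R S\<^esub> ((\<zero>\<^bsub>R\<^esub>, f) \<otimes>\<^bsub>RDirProd R S\<^esub> p) = (\<zero>\<^bsub>R\<^esub>, f) \<otimes>\<^bsub>RDirProd R S\<^esub> q) \<or>
      (\<exists>r\<in>carrier (RDirProd R S). r \<otimes>\<^bsub>RDirProd R S\<^esub> ((\<zero>\<^bsub>R\<^esub>, f) \<otimes>\<^bsub>RDirProd R S\<^esub> q) = (\<zero>\<^bsub>R\<^esub>, f) \<otimes>\<^bsub>RDirProd R S\<^esub> p)"
      unfolding mult2[OF pq(1)] mult2[OF pq(2)] div2
      using f proj(2)[OF pq(1)] proj(2)[OF pq(2)] unfolding chain_idem_def by blast
  qed (use f in \<open>auto simp: chain_idem_def RDirProd_simps\<close>)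
  have z: "\<zero>\<^bsub>RDirProd R S\<^esub> = (\<zero>\<^bsub>R\<^esub>, \<zero>\<^bsub>S\<^esub>)" by (rule RDirProd_simps(2))
  have "field_idem (RDirProd R S) (e, \<zero>\<^bsub>S\<^esub>) \<longleftrightarrow> (\<forall>p\<in>carrier (RDirProd R S).
      e \<otimes>\<^bsub>R\<^esub> fst p = \<zero>\<^bsub>R\<^esub> \<or> (\<exists>r\<in>carrier R. r \<otimes>\<^bsub>R\<^esub> (e \<otimes>\<^bsub>R\<^esub> fst p) = e))"
    unfolding field_idem_def using div1 mult1 z by (intro ball_cong refl) simp
  then show "field_idem (RDirProd R S) (e, \<zero>\<^bsub>S\<^esub>) \<longleftrightarrow> field_idem R e"
    unfolding field_idem_def by (rule trans) (rule ball1)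
  have "field_idem (RDirProd R S) (\<zero>\<^bsub>R\<^esub>, f) \<longleftrightarrow> (\<forall>p\<in>carrier (RDirProd R S).
      f \<otimes>\<^bsub>S\<^esub> snd p = \<zero>\<^bsub>S\<^esub> \<or> (\<exists>r\<in>carrier S. r \<otimes>\<^bsub>S\<^esub> (f \<otimes>\<^bsub>S\<^esub> snd p) = f))"
    unfolding field_idem_def using div2 mult2 z by (intro ball_cong refl) simp
  then show "field_idem (RDirProd R S) (\<zero>\<^bsub>R\<^esub>, f) \<longleftrightarrow> field_idem S f"
    unfolding field_idem_def by (rule trans) (rule ball2)
qed

lemma chain_decomp_RDirProd:
  assumes R: "ring R" and S: "ring S" and E: "chain_decomp R E" and F: "chain_decomp S F"
  shows "chain_decomp (RDirProd R S) ((\<lambda>e. (e, \<zero>\<^bsub>S\<^esub>)) ` E \<union> (\<lambda>f. (\<zero>\<^bsub>R\<^esub>, f)) ` F)"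
    and "(\<lambda>e. (e, \<zero>\<^bsub>S\<^esub>)) ` E \<inter> (\<lambda>f. (\<zero>\<^bsub>R\<^esub>, f)) ` F = {}"
proof -
  interpret R: ring R by fact
  interpret S: ring S by fact
  have EC: "E \<subseteq> carrier R" and FC: "F \<subseteq> carrier S"
    using E F unfolding chain_decomp_def chain_idem_def by auto
  show "(\<lambda>e. (e, \<zero>\<^bsub>S\<^esub>)) ` E \<inter> (\<lambda>f. (\<zero>\<^bsub>R\<^esub>, f)) ` F = {}"
    using E unfolding chain_decomp_def chain_idem_def by auto
  have "x = \<zero>\<^bsub>R\<^esub>" "y = \<zero>\<^bsub>S\<^esub>"
    if "x \<in> carrier R" "y \<in> carrier S" "\<forall>e\<in>E. e \<otimes>\<^bsub>R\<^esub> x = \<zero>\<^bsub>R\<^esub>" "\<forall>f\<in>F. f \<otimes>\<^bsub>S\<^esub> y = \<zero>\<^bsub>S\<^esub>" for x y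
    using that E F unfolding chain_decomp_def by auto
  moreover have "\<forall>e\<in>E. \<forall>e'\<in>E. e \<noteq> e' \<longrightarrow> e \<otimes>\<^bsub>R\<^esub> e' = \<zero>\<^bsub>R\<^esub>" "\<forall>f\<in>F. \<forall>f'\<in>F. f \<noteq> f' \<longrightarrow> f \<otimes>\<^bsub>S\<^esub> f' = \<zero>\<^bsub>S\<^esub>"
    using E F unfolding chain_decomp_def by auto
  moreover have "\<forall>e\<in>E. chain_idem (RDirProd R S) (e, \<zero>\<^bsub>S\<^esub>)" "\<forall>f\<in>F. chain_idem (RDirProd R S) (\<zero>\<^bsub>R\<^esub>, f)"
    using E F idem_RDirProd[OF R S] unfolding chain_decomp_def by auto
  moreover have "finite E" "finite F" using E F unfolding chain_decomp_def by auto
  ultimately show "chain_decomp (RDirProd R S) ((\<lambda>e. (e, \<zero>\<^bsub>S\<^esub>)) ` E \<union> (\<lambda>f. (\<zero>\<^bsub>R\<^esub>, f)) ` F)"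
    using EC FC unfolding chain_decomp_def
    by (auto simp: RDirProd_simps ball_Un subset_iff)
qed

lemma chain_decomp_one:
  assumes "ring R" "chain_idem R \<one>\<^bsub>R\<^esub>"
  shows "chain_decomp R {\<one>\<^bsub>R\<^esub>}"
proof -
  interpret ring R by fact
  show ?thesis using assms(2) unfolding chain_decomp_def by auto
qed

text \<open>The parameter \<open>b\<close> lets one induction serve both products: it is
  \<open>False\<close> for the non-fields and \<open>True\<close> for the fields. The cardinality is
  carried along because it becomes the number of copies.\<close>

lemma chain_decomp_RDirProd_list:
  assumes "\<forall>R\<in>set Rs. ring R \<and> chain_idem R \<one>\<^bsub>R\<^esub> \<and> (field_idem R \<one>\<^bsub>R\<^esub> \<longleftrightarrow> b)"
  shows "ring (RDirProd_list Rs) \<and> (\<exists>E. chain_decomp (RDirProd_list Rs) E \<and> card E = length Rs \<and>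
    (\<forall>e\<in>E. field_idem (RDirProd_list Rs) e \<longleftrightarrow> b))"
  using assms
proof (induction Rs)
  case Nil
  have "ring (RDirProd_list [])" using RDirProd_list_is_ring[of "[]"] by simp
  \<comment> \<open>The empty product is the zero ring, where completeness holds without any
    idempotent.\<close>
  moreover have "chain_decomp (RDirProd_list []) {}"
    unfolding chain_decomp_def by (simp add: monoid.defs)
  ultimately show ?case by force
next
  case (Cons R Rs)
  let ?S = "RDirProd_list Rs"
  let ?h = "\<lambda>(a, as). a # as"
  obtain E where S: "ring ?S" and E: "chain_decomp ?S E" "card E = length Rs" "\<forall>e\<in>E. field_idem ?S e \<longleftrightarrow> b"
    using Cons.IH Cons.prems by (metis (no_types, lifting) list.set_intros(2))
  have R: "ring R" and R1: "chain_idem R \<one>\<^bsub>R\<^esub>" "field_idem R \<one>\<^bsub>R\<^esub> \<longleftrightarrow> b" using Cons.prems by auto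
  have ring: "ring (RDirProd_list (R # Rs))"
  proof (rule RDirProd_list_is_ring)
    fix i assume "i < length (R # Rs)"
    then have "(R # Rs) ! i \<in> set (R # Rs)" by (rule nth_mem)
    then show "ring ((R # Rs) ! i)" using Cons.prems by blast
  qed
  let ?D = "(\<lambda>e. (e, \<zero>\<^bsub>?S\<^esub>)) ` {\<one>\<^bsub>R\<^esub>} \<union> (\<lambda>f. (\<zero>\<^bsub>R\<^esub>, f)) ` E"
  note D = chain_decomp_RDirProd[OF R S chain_decomp_one[OF R R1(1)] E(1)]
  note iso = chain_decomp_iso[OF RDirProd_ring[OF R S] ring RDirProd_list_iso1 D(1)]
  have fin: "finite E" using E unfolding chain_decomp_def by blast
  have "card (?h ` ?D) = card ?D" using iso(2) by (rule card_image)
  also have "\<dots> = card ((\<lambda>e. (e, \<zero>\<^bsub>?S\<^esub>)) ` {\<one>\<^bsub>R\<^esub>}) + card ((\<lambda>f. (\<zero>\<^bsub>R\<^esub>, f)) ` E)"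
    using D(2) fin by (intro card_Un_disjoint) auto
  also have "card ((\<lambda>f. (\<zero>\<^bsub>R\<^esub>, f)) ` E) = length Rs"
    using E(2) by (subst card_image) (auto intro: inj_onI)
  finally have "card (?h ` ?D) = length (R # Rs)" by simp
  moreover have "field_idem (RDirProd R ?S) d \<longleftrightarrow> b" if "d \<in> ?D" for d
    using that idem_RDirProd(3,4)[OF R S] R1 E(3) E(1) chain_idem_carrier
    unfolding chain_decomp_def by auto
  then have "\<forall>e\<in>?h ` ?D. field_idem (RDirProd_list (R # Rs)) e \<longleftrightarrow> b"
    using iso(3) by blast
  ultimately show ?case using iso(1) ring by blast
qed

text \<open>In substance \<open>x\<close> is the sum of its components \<open>e x\<close>. The
  partial sums are built inside \<open>J\<close> by induction and controlled through their products
  with the idempotents; the difference of \<open>x\<close> and the full sum is annihilated by all of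
  \<open>E\<close>, hence zero.\<close>

lemma (in cring) chain_decomp_mem:
  assumes E: "chain_decomp R E" and J: "ideal J R"
    and x: "x \<in> carrier R" "\<And>e. e \<in> E \<Longrightarrow> e \<otimes> x \<in> J"
  shows "x \<in> J"
proof -
  interpret J: ideal J R by fact
  have fin: "finite E" and EC: "E \<subseteq> carrier R" using E unfolding chain_decomp_def chain_idem_def by auto
  have "\<exists>s\<in>J. (\<forall>e\<in>D. e \<otimes> s = e \<otimes> x) \<and> (\<forall>e\<in>E - D. e \<otimes> s = \<zero>)" if "D \<subseteq> E" for D
    using finite_subset[OF that fin] that
  proof (induction D rule: finite_induct)
    case empty
    then show ?case using EC by (intro bexI[of _ \<zero>]) auto
  next
    case (insert d D)
    then obtain s where s: "s \<in> J" "\<forall>e\<in>D. e \<otimes> s = e \<otimes> x" "\<forall>e\<in>E - D. e \<otimes> s = \<zero>" by blast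
    have d: "d \<in> E" "d \<in> carrier R" using insert EC by auto
    have dd: "d \<otimes> d = d" using d E unfolding chain_decomp_def chain_idem_def by auto
    have sc: "s \<in> carrier R" using s J.Icarr by blast
    have *: "e \<otimes> (s \<oplus> d \<otimes> x) = e \<otimes> s \<oplus> (e \<otimes> d) \<otimes> x" if "e \<in> E" for e
      using that EC d sc x(1) by (simp add: r_distr m_assoc subset_iff)
    have orth: "e \<otimes> d = \<zero>" if "e \<in> E" "e \<noteq> d" for e
      using that d E unfolding chain_decomp_def by blast
    have "s \<oplus> d \<otimes> x \<in> J" using s x d by simp
    moreover have "e \<otimes> (s \<oplus> d \<otimes> x) = e \<otimes> x" if e: "e \<in> insert d D" for e
    proof (cases "e = d")
      case True
      then have "e \<otimes> s = \<zero>" using s(3) insert.hyps d by blast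
      then show ?thesis using *[of e] True d dd x(1) by simp
    next
      case False
      then have "e \<in> D" "e \<in> E" "e \<in> carrier R" using e insert EC by auto
      then show ?thesis using *[of e] orth[of e] s(2) False x(1) by simp
    qed
    moreover have "e \<otimes> (s \<oplus> d \<otimes> x) = \<zero>" if e: "e \<in> E - insert d D" for e
      using e *[of e] orth[of e] s(3) x(1) by auto
    ultimately show ?case by blast
  qed
  from this[of E] obtain s where s: "s \<in> J" "\<forall>e\<in>E. e \<otimes> s = e \<otimes> x" by blast
  have sc: "s \<in> carrier R" using s J.Icarr by blast
  have "e \<otimes> (x \<ominus> s) = \<zero>" if "e \<in> E" for e
  proof -
    have "e \<in> carrier R" using that EC by blast
    then have "e \<otimes> (x \<ominus> s) = e \<otimes> x \<ominus> e \<otimes> s" using x(1) sc by algebra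
    then show ?thesis using s that EC x by (auto simp: r_right_minus_eq)
  qed
  then have "x \<ominus> s = \<zero>" using E x sc unfolding chain_decomp_def by auto
  then show ?thesis using s x sc r_right_minus_eq by auto
qed

text \<open>The coordinate of an ideal \<open>I\<close> at \<open>e\<close> is the slice
  \<open>eI\<close>. An ideal is determined by its slices through \<open>chain_decomp_mem\<close>,
  and the slices at \<open>e\<close> form a chain because elements of \<open>eR\<close> are totally
  ordered by divisibility.\<close>

lemma (in cring) chain_product_ideals:
  assumes E: "chain_decomp R E" and ne: "\<exists>e\<in>E. field_idem R e" "\<exists>e\<in>E. \<not> field_idem R e"
  shows "chain_product {I. ideal I R} {\<zero>} (carrier R) E {e \<in> E. field_idem R e} (\<lambda>e I. (\<lambda>x. e \<otimes> x) ` I)"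
proof
  have idem: "e \<in> carrier R" "e \<otimes> e = e" "e \<noteq> \<zero>" if "e \<in> E" for e
    using E that unfolding chain_decomp_def chain_idem_def by auto
  have idem2: "e \<otimes> (e \<otimes> x) = e \<otimes> x" if "e \<in> E" "x \<in> carrier R" for e x
    using idem[OF that(1)] that(2) by (simp add: m_assoc[symmetric])
  have orth: "e \<otimes> (f \<otimes> x) = \<zero>" if "e \<in> E" "f \<in> E" "e \<noteq> f" "x \<in> carrier R" for e f x
  proof -
    have "e \<otimes> f = \<zero>" using E that unfolding chain_decomp_def by blast
    then show ?thesis using idem(1) that by (simp add: m_assoc[symmetric])
  qed
  show "{\<zero>} \<in> {I. ideal I R}" "carrier R \<in> {I. ideal I R}"
    using zeroideal oneideal by auto
  show "{\<zero>} \<subseteq> I" if "I \<in> {I. ideal I R}" for I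
    using that additive_subgroup.zero_closed[OF ideal.axioms(1)] by blast
  show "I \<subseteq> carrier R" if "I \<in> {I. ideal I R}" for I
    using that additive_subgroup.a_subset[OF ideal.axioms(1)] by blast
  show "I \<subseteq> J \<longleftrightarrow> (\<forall>e\<in>E. (\<lambda>x. e \<otimes> x) ` I \<subseteq> (\<lambda>x. e \<otimes> x) ` J)"
    if "I \<in> {I. ideal I R}" "J \<in> {I. ideal I R}" for I J
  proof (intro iffI ballI image_mono)
    interpret I: ideal I R using that by simp
    interpret J: ideal J R using that by simp
    assume sub: "\<forall>e\<in>E. (\<lambda>x. e \<otimes> x) ` I \<subseteq> (\<lambda>x. e \<otimes> x) ` J"
    show "I \<subseteq> J"
    proof
      fix x assume x: "x \<in> I"
      have "e \<otimes> x \<in> J" if e: "e \<in> E" for e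
      proof -
        have "e \<otimes> x \<in> (\<lambda>x. e \<otimes> x) ` J" using sub x e by blast
        then show ?thesis using J.I_l_closed idem(1)[OF e] by auto
      qed
      then show "x \<in> J" using chain_decomp_mem[OF E J.is_ideal I.Icarr[OF x]] by blast
    qed
  qed
  show "(\<lambda>x. e \<otimes> x) ` I \<subseteq> (\<lambda>x. e \<otimes> x) ` J \<or> (\<lambda>x. e \<otimes> x) ` J \<subseteq> (\<lambda>x. e \<otimes> x) ` I"
    if e: "e \<in> E" and IJ: "I \<in> {I. ideal I R}" "J \<in> {I. ideal I R}" for e I J
  proof (rule ccontr)
    interpret I: ideal I R using IJ by simp
    interpret J: ideal J R using IJ by simp
    assume "\<not> ?thesis"
    then obtain a b where a: "a \<in> I" "e \<otimes> a \<notin> (\<lambda>x. e \<otimes> x) ` J" and b: "b \<in> J" "e \<otimes> b \<notin> (\<lambda>x. e \<otimes> x) ` I"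
      by blast
    have ac: "a \<in> carrier R" "b \<in> carrier R" using a b I.Icarr J.Icarr by auto
    \<comment> \<open>Multiples of \<open>e a\<close> stay in the slice of \<open>I\<close>, since
      \<open>r (e a) = e (r a)\<close>, and likewise for \<open>b\<close> and \<open>J\<close>. So
      neither of \<open>e a\<close>, \<open>e b\<close> divides the other.\<close>
    have no: "r \<otimes> (e \<otimes> a) \<noteq> e \<otimes> b" "r \<otimes> (e \<otimes> b) \<noteq> e \<otimes> a" if r: "r \<in> carrier R" for r
    proof -
      have "r \<otimes> (e \<otimes> a) = e \<otimes> (r \<otimes> a)" "r \<otimes> (e \<otimes> b) = e \<otimes> (r \<otimes> b)"
        using r ac idem(1)[OF e] by (simp_all only: m_lcomm)
      moreover have "r \<otimes> a \<in> I" "r \<otimes> b \<in> J" using r a b I.I_l_closed J.I_l_closed by auto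
      ultimately show "r \<otimes> (e \<otimes> a) \<noteq> e \<otimes> b" "r \<otimes> (e \<otimes> b) \<noteq> e \<otimes> a"
        using a(2) b(2) by (metis imageI)+
    qed
    have "chain_idem R e" using E e unfolding chain_decomp_def by blast
    then show False using ac no unfolding chain_idem_def by blast
  qed
  show "\<exists>u\<in>{I. ideal I R}. \<forall>e\<in>E. (\<lambda>x. e \<otimes> x) ` u = (\<lambda>x. e \<otimes> x) ` f e"
    if f': "\<And>e. e \<in> E \<Longrightarrow> f e \<in> {I. ideal I R}" for f
  proof
    have f: "ideal (f e) R" if "e \<in> E" for e using f'[OF that] by simp
    have f0: "\<zero> \<in> f e" if "e \<in> E" for e
      using additive_subgroup.zero_closed[OF ideal.axioms(1)[OF f[OF that]]] .
    \<comment> \<open>The ideal with the prescribed slices. Its slice at \<open>e\<close> is all of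
      \<open>e (f e)\<close>, because by orthogonality the other components of \<open>e y\<close>
      vanish and so lie in every ideal.\<close>
    define u where "u = {x \<in> carrier R. \<forall>e\<in>E. e \<otimes> x \<in> f e}"
    have "ideal u R"
    proof (rule idealI[OF ring_axioms])
      show "subgroup u (add_monoid R)"
      proof (rule add.subgroupI)
        show "u \<subseteq> carrier R" unfolding u_def by blast
        show "u \<noteq> {}" unfolding u_def using f0 idem(1) by auto
        fix x assume x: "x \<in> u"
        show "\<ominus> x \<in> u"
          using x idem(1) additive_subgroup.a_inv_closed[OF ideal.axioms(1)[OF f]]
          unfolding u_def by (auto simp: r_minus)
        fix y assume "y \<in> u"
        then show "x \<oplus> y \<in> u"
          using x idem(1) additive_subgroup.a_closed[OF ideal.axioms(1)[OF f]]
          unfolding u_def by (auto simp: r_distr)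
      qed
      fix x r assume x: "x \<in> u" and r: "r \<in> carrier R"
      have "e \<otimes> (r \<otimes> x) \<in> f e" if e: "e \<in> E" for e
      proof -
        have "e \<otimes> (r \<otimes> x) = r \<otimes> (e \<otimes> x)"
          using r x idem(1)[OF e] unfolding u_def by (simp add: m_lcomm)
        then show ?thesis using x e r ideal.I_l_closed[OF f[OF e]] unfolding u_def by simp
      qed
      then show "r \<otimes> x \<in> u" using x r unfolding u_def by simp
      then show "x \<otimes> r \<in> u" using x r m_comm unfolding u_def by simp
    qed
    then show "u \<in> {I. ideal I R}" by simp
    show "\<forall>e\<in>E. (\<lambda>x. e \<otimes> x) ` u = (\<lambda>x. e \<otimes> x) ` f e"
    proof
      fix e assume e: "e \<in> E"
      show "(\<lambda>x. e \<otimes> x) ` u = (\<lambda>x. e \<otimes> x) ` f e"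
      proof
        show "(\<lambda>x. e \<otimes> x) ` u \<subseteq> (\<lambda>x. e \<otimes> x) ` f e"
        proof clarify
          fix x assume "x \<in> u"
          then have "e \<otimes> x \<in> f e" "e \<otimes> x = e \<otimes> (e \<otimes> x)" using e idem2 unfolding u_def by auto
          then show "e \<otimes> x \<in> (\<lambda>x. e \<otimes> x) ` f e" by (metis imageI)
        qed
        show "(\<lambda>x. e \<otimes> x) ` f e \<subseteq> (\<lambda>x. e \<otimes> x) ` u"
        proof clarify
          fix y assume y: "y \<in> f e"
          have yc: "y \<in> carrier R" using y ideal.Icarr[OF f[OF e]] by blast
          have "e \<otimes> y \<in> f e" using ideal.I_l_closed[OF f[OF e] y idem(1)[OF e]] .
          then have "d \<otimes> (e \<otimes> y) \<in> f d" if "d \<in> E" for d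
            using orth[OF that e _ yc] idem2[OF e yc] f0[OF that] by (cases "d = e") auto
          then have "e \<otimes> y \<in> u" unfolding u_def using yc idem(1)[OF e] by simp
          then show "e \<otimes> y \<in> (\<lambda>x. e \<otimes> x) ` u" using idem2[OF e yc] by (metis imageI)
        qed
      qed
    qed
  qed
  show "(\<lambda>x. e \<otimes> x) ` {\<zero>} \<noteq> (\<lambda>x. e \<otimes> x) ` carrier R" if e: "e \<in> E" for e
  proof -
    have "e \<in> (\<lambda>x. e \<otimes> x) ` carrier R" using idem[OF e] by (metis imageI)
    moreover have "(\<lambda>x. e \<otimes> x) ` {\<zero>} = {\<zero>}" using idem(1)[OF e] by simp
    ultimately show ?thesis using idem(3)[OF e] by auto
  qed
  show "(\<lambda>x. e \<otimes> x) ` I = (\<lambda>x. e \<otimes> x) ` {\<zero>} \<or> (\<lambda>x. e \<otimes> x) ` I = (\<lambda>x. e \<otimes> x) ` carrier R"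
    if e': "e \<in> {e \<in> E. field_idem R e}" and I: "I \<in> {I. ideal I R}" for e I
  proof -
    interpret I: ideal I R using I by simp
    have e: "e \<in> E" "field_idem R e" using e' by auto
    show ?thesis
    proof (cases "\<forall>a\<in>I. e \<otimes> a = \<zero>")
      case True
      moreover have "I \<noteq> {}" using I.zero_closed by blast
      ultimately have "(\<lambda>x. e \<otimes> x) ` I = (\<lambda>x. e \<otimes> x) ` {\<zero>}"
        using idem(1)[OF e(1)] by (auto simp: image_iff)
      then show ?thesis by blast
    next
      case False
      then obtain a where a: "a \<in> I" "e \<otimes> a \<noteq> \<zero>" by blast
      have ac: "a \<in> carrier R" using a I.Icarr by blast
      obtain r where r: "r \<in> carrier R" "r \<otimes> (e \<otimes> a) = e"
        using e(2) a ac unfolding field_idem_def by blast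
      have "e \<otimes> x \<in> (\<lambda>x. e \<otimes> x) ` I" if x: "x \<in> carrier R" for x
      proof -
        have "e \<otimes> x = (r \<otimes> (e \<otimes> a)) \<otimes> x" using r by simp
        also have "\<dots> = e \<otimes> ((r \<otimes> x) \<otimes> a)"
          using r(1) ac idem(1)[OF e(1)] x by (simp only: m_ac m_closed)
        finally show ?thesis using a r x I.I_l_closed by blast
      qed
      then show ?thesis using I.Icarr by blast
    qed
  qed
  show "\<exists>I\<in>{I. ideal I R}. (\<lambda>x. e \<otimes> x) ` I \<noteq> (\<lambda>x. e \<otimes> x) ` {\<zero>} \<and> (\<lambda>x. e \<otimes> x) ` I \<noteq> (\<lambda>x. e \<otimes> x) ` carrier R"
    if e': "e \<in> E - {e \<in> E. field_idem R e}" for e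
  proof -
    have e: "e \<in> E" "\<not> field_idem R e" using e' by auto
    obtain a where a: "a \<in> carrier R" "e \<otimes> a \<noteq> \<zero>" "\<And>r. r \<in> carrier R \<Longrightarrow> r \<otimes> (e \<otimes> a) \<noteq> e"
      using e(2) unfolding field_idem_def by blast
    \<comment> \<open>As \<open>a\<close> refutes \<open>field_idem\<close>, the ideal generated by
      \<open>e a\<close> has a nonzero slice at \<open>e\<close> that misses \<open>e\<close>
      itself, which is an inner value of this chain.\<close>
    let ?I = "PIdl (e \<otimes> a)"
    have ea: "e \<otimes> a \<in> carrier R" using idem(1)[OF e(1)] a by simp
    have I: "?I \<in> {I. ideal I R}" using cgenideal_ideal[OF ea] by simp
    have "e \<otimes> a \<in> (\<lambda>x. e \<otimes> x) ` ?I"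
      using cgenideal_self[OF ea] idem2[OF e(1) a(1)] by (metis imageI)
    moreover have "e \<otimes> a \<notin> (\<lambda>x. e \<otimes> x) ` {\<zero>}" using a idem(1)[OF e(1)] by simp
    moreover have "e \<in> (\<lambda>x. e \<otimes> x) ` carrier R" using idem[OF e(1)] by (metis imageI)
    moreover have "e \<notin> (\<lambda>x. e \<otimes> x) ` ?I"
    proof
      assume "e \<in> (\<lambda>x. e \<otimes> x) ` ?I"
      then obtain s where s: "s \<in> carrier R" "e = e \<otimes> (s \<otimes> (e \<otimes> a))"
        unfolding cgenideal_def by blast
      have "e \<otimes> (s \<otimes> (e \<otimes> a)) = s \<otimes> (e \<otimes> (e \<otimes> a))"
        using s(1) ea idem(1)[OF e(1)] by (simp only: m_lcomm)
      also have "\<dots> = s \<otimes> (e \<otimes> a)" using idem2[OF e(1) a(1)] by simp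
      finally show False using a(3)[OF s(1)] s(2) by simp
    qed
    ultimately have "(\<lambda>x. e \<otimes> x) ` ?I \<noteq> (\<lambda>x. e \<otimes> x) ` {\<zero>} \<and> (\<lambda>x. e \<otimes> x) ` ?I \<noteq> (\<lambda>x. e \<otimes> x) ` carrier R"
      by metis
    then show ?thesis using I by (rule bexI)
  qed
qed (use ne in auto)

section \<open>The individual factors and the conclusion for \<open>R\<close>\<close>

lemma (in local_artinian_pir) one_idem:
  assumes "\<not> field R"
  shows "chain_idem R \<one>" "\<not> field_idem R \<one>"
proof -
  obtain M where M: "maximalideal M R" using unique_maximalideal by blast
  interpret M: maximalideal M R by fact
  \<comment> \<open>A maximal ideal is proper, which excludes the zero ring.\<close>
  have nz: "\<one> \<noteq> \<zero>"
    using M.I_notcarr M.one_imp_carrier M.zero_closed by metis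
  then show "chain_idem R \<one>"
    unfolding chain_idem_def using dvd_total by auto
  show "\<not> field_idem R \<one>"
  proof
    assume "field_idem R \<one>"
    then have "\<exists>b\<in>carrier R. a \<otimes> b = \<one>" if "a \<in> carrier R" "a \<noteq> \<zero>" for a
      using that unfolding field_idem_def by (metis l_one m_comm)
    then show False using cring_fieldI2 nz assms by metis
  qed
qed

lemma (in field) one_idem:
  shows "chain_idem R \<one>" "field_idem R \<one>"
proof -
  have inv: "\<exists>r\<in>carrier R. r \<otimes> a = b" if "a \<in> carrier R" "b \<in> carrier R" "a \<noteq> \<zero>" for a b
  proof
    have u: "a \<in> Units R" using that field_Units by blast
    show "b \<otimes> inv a \<in> carrier R" using u that by simp
    show "b \<otimes> inv a \<otimes> a = b" using u that by (simp add: m_assoc)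
  qed
  show "field_idem R \<one>" unfolding field_idem_def using inv by auto
  have "(\<exists>r\<in>carrier R. r \<otimes> a = b) \<or> (\<exists>r\<in>carrier R. r \<otimes> b = a)"
    if "a \<in> carrier R" "b \<in> carrier R" for a b
  proof (cases "a = \<zero>")
    case True
    then show ?thesis using that l_null by blast
  qed (use inv[OF that] in blast)
  then show "chain_idem R \<one>" unfolding chain_idem_def by auto
qed

theorem lemma3p7:
  fixes m n :: nat
    and R :: "'a ring"
    and Rs :: "nat \<Rightarrow> 'b ring"
    and Fs :: "nat \<Rightarrow> 'c ring"
    and S :: "'b list ring"
    and T :: "'c list ring"
  assumes "m \<ge> 1" and "n \<ge> 1"
    and "cring R"
    and "\<And>i. 1 \<le> i \<Longrightarrow> i \<le> m \<Longrightarrow> local_artinian_pir (Rs i)"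
    and "\<And>i. 1 \<le> i \<Longrightarrow> i \<le> m \<Longrightarrow> \<not> field (Rs i)"
    and "\<And>j. 1 \<le> j \<Longrightarrow> j \<le> n \<Longrightarrow> field (Fs j)"
    and "S = RDirProd_list (map Rs [1..<Suc m])"
    and "T = RDirProd_list (map Fs [1..<Suc n])"
    and "R \<simeq> RDirProd S T"
  shows "\<exists>H :: 'a set pair_pre_digraph.
           pair_bidirected_digraph H \<and> connected_or_null H \<and>
           digraph_iso
             (with_proj (strong_resolving_graph (inclusion_ideal_graph R)))
             (with_proj (disjoint_graph_union H (graph_copies n (complete_graph 2))))"
proof -
  interpret R: cring R by fact
  have "\<forall>R\<in>set (map Rs [1..<Suc m]). ring R \<and> chain_idem R \<one>\<^bsub>R\<^esub> \<and> (field_idem R \<one>\<^bsub>R\<^esub> \<longleftrightarrow> False)"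
  proof
    fix Q assume "Q \<in> set (map Rs [1..<Suc m])"
    then obtain i where i: "1 \<le> i" "i \<le> m" "Q = Rs i" by auto
    interpret local_artinian_pir Q using assms(4) i by blast
    show "ring Q \<and> chain_idem Q \<one>\<^bsub>Q\<^esub> \<and> (field_idem Q \<one>\<^bsub>Q\<^esub> \<longleftrightarrow> False)"
      using one_idem assms(5) i ring_axioms by blast
  qed
  from chain_decomp_RDirProd_list[OF this] obtain A where S: "ring S"
    and A: "chain_decomp S A" "card A = m" "\<forall>e\<in>A. \<not> field_idem S e"
    using assms(7) by auto
  have "\<forall>R\<in>set (map Fs [1..<Suc n]). ring R \<and> chain_idem R \<one>\<^bsub>R\<^esub> \<and> (field_idem R \<one>\<^bsub>R\<^esub> \<longleftrightarrow> True)"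
  proof
    fix Q assume "Q \<in> set (map Fs [1..<Suc n])"
    then obtain j where j: "1 \<le> j" "j \<le> n" "Q = Fs j" by auto
    interpret field Q using assms(6) j by blast
    show "ring Q \<and> chain_idem Q \<one>\<^bsub>Q\<^esub> \<and> (field_idem Q \<one>\<^bsub>Q\<^esub> \<longleftrightarrow> True)"
      using one_idem ring_axioms by blast
  qed
  from chain_decomp_RDirProd_list[OF this] obtain B where T: "ring T"
    and B: "chain_decomp T B" "card B = n" "\<forall>e\<in>B. field_idem T e"
    using assms(8) by auto
  obtain h where "h \<in> ring_iso R (RDirProd S T)"
    using assms(9) unfolding is_ring_iso_def by blast
  then obtain g where g: "g \<in> ring_iso (RDirProd S T) R"
    using ring_iso_set_sym[OF R.ring_axioms] by blast
  \<comment> \<open>The idempotents of the non-fields and of the fields, kept apart so that the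
    \<open>n\<close> images of \<open>?B\<close> are identified as the two-element chains.\<close>
  let ?A = "(\<lambda>e. (e, \<zero>\<^bsub>T\<^esub>)) ` A" and ?B = "(\<lambda>f. (\<zero>\<^bsub>S\<^esub>, f)) ` B"
  note D = chain_decomp_RDirProd[OF S T A(1) B(1)]
  note iso = chain_decomp_iso[OF RDirProd_ring[OF S T] R.ring_axioms g D(1)]
  let ?E = "g ` (?A \<union> ?B)"
  have fA: "\<not> field_idem R e" if "e \<in> g ` ?A" for e
    using that iso(3) A(3) idem_RDirProd(3)[OF S T] by auto
  have fB: "field_idem R e" if "e \<in> g ` ?B" for e
    using that iso(3) B(3) idem_RDirProd(4)[OF S T] by auto
  have F: "{e \<in> ?E. field_idem R e} = g ` ?B"
    using fA fB by blast
  have "A \<noteq> {}" "B \<noteq> {}" using assms(1,2) A(2) B(2) by auto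
  then have "\<exists>e\<in>?E. field_idem R e" "\<exists>e\<in>?E. \<not> field_idem R e"
    using fA fB by blast+
  from R.chain_product_ideals[OF iso(1) this]
  interpret CP: chain_product "{I. ideal I R}" "{\<zero>\<^bsub>R\<^esub>}" "carrier R" ?E "g ` ?B" "\<lambda>e I. (\<lambda>x. e \<otimes>\<^bsub>R\<^esub> x) ` I"
    unfolding F .
  have "CP.G = inclusion_ideal_graph R"
    unfolding CP.G_def CP.V_def inclusion_ideal_graph_def Let_def by auto
  moreover have "card (g ` ?B) = n"
  proof -
    have "card (g ` ?B) = card ?B"
      using inj_on_subset[OF iso(2)] by (intro card_image) blast
    also have "\<dots> = n"
      using B(2) by (subst card_image) (auto intro: inj_onI)
    finally show ?thesis .
  qed
  moreover have "finite (g ` ?B)" using B(1) unfolding chain_decomp_def by blast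
  ultimately show ?thesis
    using CP.strong_resolving_graph_iso CP.H_bidirected CP.H_connected by auto
qed

end
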